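(* In the setting described in the context, assume (A1)--(A8) stated there. Let $\beta>0$ and $q\in[1,\infty]$. Then there exists $c_1>0$ such that for each $f\in L^2(L,\nu)$, $$c_1\left\|\left\{\alpha^{n\beta}\left(\alpha^{nd}\iint_{\{(x,y)\in L\times L:\mathsf d(x,y)<k_1\alpha^{-n}\}}|f(x)-f(y)|^2\,d\nu(x)\,d\nu(y)\right)^{1/2}\right\}_{n=0}^\infty\right\|_{l^q}$$ $$\le\left\|\left\{\alpha^{n\beta}\left(\alpha^{-nd}E_{(n)}(Q_nf)\right)^{1/2}\right\}_{n=0}^\infty\right\|_{l^q}$$ $$\le\left\|\left\{\alpha^{n\beta}\left(\alpha^{nd}\iint_{\{(x,y)\in L\times L:\mathsf d(x,y)<k_2\alpha^{-n}\}}|f(x)-f(y)|^2\,d\nu(x)\,d\nu(y)\right)^{1/2}\right\}_{n=0}^\infty\right\|_{l^q},$$ where $k_1,k_2$ are the constants in (A2).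
   Context: **Self-similar sets.** $(X,\mathsf d)$ is a complete separable metric space, $\alpha>1$, $W$ is a finite index set, and $F_i:X\to X$ ($i\in W$) satisfy $\mathsf d(F_i(x),F_i(y))=\alpha^{-1}\mathsf d(x,y)$ for all $x,y\in X$. $S\subset W$, $N=\#S$, and $K$ is the unique nonempty compact set with $K=\bigcup_{i\in S}F_i(K)$; $K$ is assumed connected. $W^n$ is the set of words of length $n$ over $W$ ($W^0=\{\emptyset\}$); $F_{w_1\cdots w_n}=F_{w_1}\circ\cdots\circ F_{w_n}$, $F_\emptyset=\mathrm{id}$, $K_w=F_w(K)$, $F_w^*f=f\circ F_w$. $\mathfrak G$ is a group of isometries of $K$ such that (i) for each $i\in W$ there are $j\in S$, $\Psi_i\in\mathfrak G$ with $F_i=F_j\circ\Psi_i$ on $K$; (ii) for each $\Psi\in\mathfrak G$, $i\in S$ there are $\hat\Psi\in\mathfrak G$, $\hat i\in S$ with $\Psi\circ F_i=F_{\hat i}\circ\hat\Psi$. $\pi:W^{\mathbb N}\to K$ is given by $\{\pi(w)\}=\bigcap_mK_{w_1\cdots w_m}$. For $v,w\in W^n$ write $v\stackrel{n,K}{\sim}w$ if $K_v\cap K_w\neq\emptyset$. For $A\subset W^n$: $\mathcal N_0(A)=A$, $\mathcal N_k(A)=\{v\in W^n: v\stackrel{n,K}{\sim}u\text{ for some }u\in\mathcal N_{k-1}(A)\}$, $\mathcal N_k(w)=\mathcal N_k(\{w\})$. $I\subset W$ with $N_I=\#I<N$; $L\subset K$ is the unique nonempty compact set with $L=\bigcup_{i\in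 I}F_i(L)$; $L_w=F_w(L)$ for $w\in I^n$. $M\in\mathbb N$ is fixed; for $v,w\in I^n$ write $v\stackrel{n,L}{\leftrightarrow}w$ if $v\in\mathcal N_M(w)$; $M$ is chosen so that any $i,j\in I$ are joined by a finite chain $i\stackrel{1,L}{\leftrightarrow}i_1\stackrel{1,L}{\leftrightarrow}\cdots\stackrel{1,L}{\leftrightarrow}j$ in $I$. $\mu$ (on $K$) and $\nu$ (on $L$) are the images under $\pi$ of the uniform Bernoulli (product) probability measures on $S^{\mathbb N}$ and $I^{\mathbb N}$. $d_f=\log N/\log\alpha$, $d=\log N_I/\log\alpha$. $(\mathcal E,\mathcal F)$ is a strong local regular Dirichlet form on $L^2(K,\mu)$; $\mathcal E(f)=\mathcal E(f,f)$, $\|f\|_{\mathcal F}=(\mathcal E(f)+\|f\|^2_{L^2(\mu)})^{1/2}$. (A1) $\sup_n\max_{w\in S^n}\#(\mathcal N_1(w)\cap S^n)<\infty$ and $\sup_n\max_{w\in I^n}\#(\mathcal N_M(w)\cap I^n)<\infty$. (A2) There are $k_1,k_2>0$ such that for $x,y\in L$, $n\in\mathbb Z_+$, $v,w\in I^n$ with $x\in K_v,y\in K_w$: $\mathsf d(x,y)<k_1\alpha^{-n}$ implies $v\stackrel{n,L}{\leftrightarrow}w$, and $v\stackrel{n,L}{\leftrightarrow}w$ implies $\mathsf d(x,y)<k_2\alpha^{-n}$. (A3) There are constants $k_1',k_2'>0$ such that for $x,y\in K$, $n\in\mathbb Z_+$, $v,w\in S^n$ with $x\in K_v,y\in K_w$: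 $\mathsf d(x,y)<k_1'\alpha^{-n}$ implies $v\stackrel{n,K}{\sim}w$, and $v\stackrel{n,K}{\sim}w$ implies $\mathsf d(x,y)<k_2'\alpha^{-n}$. (A4) $\mu(\{x\in K:\#(\pi^{-1}(x)\cap S^{\mathbb N})=\infty\})=0$ and $\nu(\{x\in L:\#(\pi^{-1}(x)\cap I^{\mathbb N})=\infty\})=0$. (A5) $F_i^*f\in\mathcal F$ for $f\in\mathcal F$, $i\in S$, and there is $\rho>0$ with $\mathcal E(f)=\rho\sum_{i\in S}\mathcal E(F_i^*f)$ for $f\in\mathcal F$. (A6) For $\Psi\in\mathfrak G$, $\{f\circ\Psi:f\in\mathcal F\}=\mathcal F$ and $\mathcal E(f\circ\Psi)=\mathcal E(f)$ for $f\in\mathcal F$. (A7) $d_w:=\log(\rho N)/\log\alpha>d_f-d$. (A8) There is $c>0$ with $\nu(D)\le c\,\mathrm{Cap}(D)$ for every compact $D\subset K$, where $\mathrm{Cap}(U)=\inf\{\|u\|_{\mathcal F}^2:u\in\mathcal F,u\ge1\ \mu\text{-a.e. on }U\}$ for open $U\subset K$ and $\mathrm{Cap}(D)=\inf\{\mathrm{Cap}(U):U\supset D\text{ open}\}$. For $f\in L^1(L,\nu)$ and $w\in I^n$, $Q_nf(w)=\nu(L_w)^{-1}\int_{L_w}f\,d\nu$. For $g\in\mathbb R^{I^n}$, $E_{(n)}(g)=E_{(n)}(g,g)=\sum_{v,w\in I^n,\ v\stackrel{n,L}{\leftrightarrow}w}(g(v)-g(w))^2$ (sum over ordered pairs). 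*)

theory Defs
  imports "HOL-Probability.Probability" "HOL-Algebra.Bij"
begin

section \<open>Words, cells and the coding map\<close>

definition words :: "'i set \<Rightarrow> nat \<Rightarrow> 'i list set" where
  "words A n = {w. set w \<subseteq> A \<and> length w = n}"

text \<open>\<open>foldr F w\<close> is the composition of \<open>F i\<close> for \<open>i\<close> running through the letters of \<open>w\<close>, the
  first letter outermost; so \<open>cell F K w\<close> is \<open>K\<^sub>w\<close> and \<open>cell F L w\<close> is \<open>L\<^sub>w\<close>.\<close>

definition cell :: "('i \<Rightarrow> 'a \<Rightarrow> 'a) \<Rightarrow> 'a set \<Rightarrow> 'i list \<Rightarrow> 'a set" where
  "cell F B w = foldr F w ` B"

text \<open>The value of \<open>coding F K\<close> is meaningful when the cells along \<open>\<omega>\<close> intersect in one point,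
  which is the case for all sequences over the index set of contractions mapping the compact
  set \<open>K\<close> into itself.  Sequences are indexed from 0, so \<open>map \<omega> [0..<m]\<close> is the initial word of
  length \<open>m\<close>.\<close>

definition coding :: "('i \<Rightarrow> 'a \<Rightarrow> 'a) \<Rightarrow> 'a set \<Rightarrow> (nat \<Rightarrow> 'i) \<Rightarrow> 'a" where
  "coding F K \<omega> = (THE x. (\<Inter>m. cell F K (map \<omega> [0..<m])) = {x})"

text \<open>Image, as a Borel measure on the subspace \<open>B\<close>, of the uniform Bernoulli measure on
  \<open>A\<^sup>\<nat>\<close>.  Its space is \<open>B\<close>.\<close>

definition bernoulli_image ::
    "('i \<Rightarrow> 'a \<Rightarrow> 'a::topological_space) \<Rightarrow> 'a set \<Rightarrow> 'i set \<Rightarrow> 'a set \<Rightarrow> 'a measure" where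
  "bernoulli_image F K A B =
     distr (PiM (UNIV :: nat set) (\<lambda>_. uniform_count_measure A)) (restrict_space borel B) (coding F K)"

text \<open>\<open>nbhd F K W n k A\<close> is \<open>\<N>\<^sub>k(A)\<close> for \<open>A\<close> a set of words of length \<open>n\<close> over \<open>W\<close>.\<close>

primrec nbhd ::
    "('i \<Rightarrow> 'a \<Rightarrow> 'a) \<Rightarrow> 'a set \<Rightarrow> 'i set \<Rightarrow> nat \<Rightarrow> nat \<Rightarrow> 'i list set \<Rightarrow> 'i list set" where
  "nbhd F K W n 0 A = A"
| "nbhd F K W n (Suc k) A =
     {v \<in> words W n. \<exists>u \<in> nbhd F K W n k A. cell F K v \<inter> cell F K u \<noteq> {}}"

text \<open>The relation between words of length \<open>n\<close> over \<open>I\<close>; the connecting chain of length \<open>M\<close>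
  may use arbitrary words over \<open>W\<close>.\<close>

definition linked ::
    "('i \<Rightarrow> 'a \<Rightarrow> 'a) \<Rightarrow> 'a set \<Rightarrow> 'i set \<Rightarrow> 'i set \<Rightarrow> nat \<Rightarrow> nat \<Rightarrow> 'i list \<Rightarrow> 'i list \<Rightarrow> bool" where
  "linked F K W I M n v w \<longleftrightarrow> v \<in> words I n \<and> w \<in> words I n \<and> v \<in> nbhd F K W n M {w}"

section \<open>Dirichlet forms\<close>

text \<open>Elements of \<open>L\<^sup>2\<close> are represented by functions; almost everywhere equal functions are not
  identified, so all notions below are required to be invariant under a.e. modification.\<close>

definition L2 :: "'a measure \<Rightarrow> ('a \<Rightarrow> real) set" where
  "L2 M = {f \<in> borel_measurable M. integrable M (\<lambda>x. (f x)\<^sup>2)}"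

text \<open>The square of the norm of the form domain.\<close>

definition dnorm2 :: "'a measure \<Rightarrow> (('a \<Rightarrow> real) \<Rightarrow> ('a \<Rightarrow> real) \<Rightarrow> real) \<Rightarrow> ('a \<Rightarrow> real) \<Rightarrow> real" where
  "dnorm2 M \<E> f = \<E> f f + (LINT x|M. (f x)\<^sup>2)"

locale dirichlet_form =
  fixes M :: "'a measure"
    and \<E> :: "('a \<Rightarrow> real) \<Rightarrow> ('a \<Rightarrow> real) \<Rightarrow> real"
    and \<F> :: "('a \<Rightarrow> real) set"
  assumes dom_L2: "\<F> \<subseteq> L2 M"
    and dom_ae: "\<lbrakk>f \<in> \<F>; g \<in> borel_measurable M; AE x in M. f x = g x\<rbrakk> \<Longrightarrow> g \<in> \<F>"
    and form_ae: "\<lbrakk>f \<in> \<F>; g \<in> \<F>; h \<in> \<F>; AE x in M. f x = g x\<rbrakk> \<Longrightarrow> \<E> f h = \<E> g h"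
    and dom_zero: "(\<lambda>_. 0) \<in> \<F>"
    and dom_add: "\<lbrakk>f \<in> \<F>; g \<in> \<F>\<rbrakk> \<Longrightarrow> (\<lambda>x. f x + g x) \<in> \<F>"
    and dom_scale: "f \<in> \<F> \<Longrightarrow> (\<lambda>x. c * f x) \<in> \<F>"
    and dom_dense: "\<lbrakk>f \<in> L2 M; \<epsilon> > 0\<rbrakk> \<Longrightarrow> \<exists>g\<in>\<F>. (LINT x|M. (f x - g x)\<^sup>2) < \<epsilon>"
    and form_sym: "\<lbrakk>f \<in> \<F>; g \<in> \<F>\<rbrakk> \<Longrightarrow> \<E> f g = \<E> g f"
    and form_add: "\<lbrakk>f \<in> \<F>; g \<in> \<F>; h \<in> \<F>\<rbrakk> \<Longrightarrow> \<E> (\<lambda>x. f x + g x) h = \<E> f h + \<E> g h"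
    and form_scale: "\<lbrakk>f \<in> \<F>; h \<in> \<F>\<rbrakk> \<Longrightarrow> \<E> (\<lambda>x. c * f x) h = c * \<E> f h"
    and form_nonneg: "f \<in> \<F> \<Longrightarrow> \<E> f f \<ge> 0"
    and closed: "\<lbrakk>\<And>n::nat. u n \<in> \<F>;
        \<And>\<epsilon>. \<epsilon> > 0 \<Longrightarrow> \<exists>n0. \<forall>m\<ge>n0. \<forall>n\<ge>n0. dnorm2 M \<E> (\<lambda>x. u m x - u n x) < \<epsilon>\<rbrakk>
      \<Longrightarrow> \<exists>v\<in>\<F>. (\<lambda>n. dnorm2 M \<E> (\<lambda>x. u n x - v x)) \<longlonglongrightarrow> 0"
    and markov: "f \<in> \<F> \<Longrightarrow> (\<lambda>x. min (max (f x) 0) 1) \<in> \<F>"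
      "f \<in> \<F> \<Longrightarrow> \<E> (\<lambda>x. min (max (f x) 0) 1) (\<lambda>x. min (max (f x) 0) 1) \<le> \<E> f f"

text \<open>The support, in \<open>space M\<close>, of the measure with density \<open>u\<close>.\<close>

definition ess_support :: "'a::topological_space measure \<Rightarrow> ('a \<Rightarrow> real) \<Rightarrow> 'a set" where
  "ess_support M u = {x \<in> space M. \<forall>U. open U \<and> x \<in> U \<longrightarrow> \<not> (AE y in M. y \<in> U \<longrightarrow> u y = 0)}"

text \<open>Only compact state spaces are considered.  Thus the continuous functions with compact support
  are all continuous functions on \<open>space M\<close>, and the requirement of compact supports in the
  definition of strong locality is void.\<close>

locale strong_local_regular_dirichlet_form = dirichlet_form M \<E> \<F>
  for M :: "'a::metric_space measure"
    and \<E> :: "('a \<Rightarrow> real) \<Rightarrow> ('a \<Rightarrow> real) \<Rightarrow> real"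
    and \<F> :: "('a \<Rightarrow> real) set" +
  assumes compact_space: "compact (space M)"
    and core_dense: "\<lbrakk>f \<in> \<F>; \<epsilon> > 0\<rbrakk> \<Longrightarrow>
        \<exists>g\<in>\<F>. continuous_on (space M) g \<and> dnorm2 M \<E> (\<lambda>x. f x - g x) < \<epsilon>"
    and core_uniformly_dense: "\<lbrakk>continuous_on (space M) f; \<epsilon> > 0\<rbrakk> \<Longrightarrow>
        \<exists>g\<in>\<F>. continuous_on (space M) g \<and> (\<forall>x\<in>space M. \<bar>f x - g x\<bar> < \<epsilon>)"
    and strong_local: "\<lbrakk>u \<in> \<F>; v \<in> \<F>; open U; ess_support M u \<subseteq> U;
        AE x in M. x \<in> U \<longrightarrow> v x = c\<rbrakk> \<Longrightarrow> \<E> u v = 0"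

definition cap_open ::
    "'a measure \<Rightarrow> (('a \<Rightarrow> real) \<Rightarrow> ('a \<Rightarrow> real) \<Rightarrow> real) \<Rightarrow> ('a \<Rightarrow> real) set \<Rightarrow> 'a set \<Rightarrow> ennreal" where
  "cap_open M \<E> \<F> U =
     (INF u \<in> {u \<in> \<F>. AE x in M. x \<in> U \<longrightarrow> u x \<ge> 1}. ennreal (dnorm2 M \<E> u))"

definition cap ::
    "'a::topological_space measure \<Rightarrow> (('a \<Rightarrow> real) \<Rightarrow> ('a \<Rightarrow> real) \<Rightarrow> real) \<Rightarrow> ('a \<Rightarrow> real) set
      \<Rightarrow> 'a set \<Rightarrow> ennreal" where
  "cap M \<E> \<F> D =
     (INF U \<in> {U. openin (top_of_set (space M)) U \<and> D \<subseteq> U}. cap_open M \<E> \<F> U)"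

section \<open>Averages, discrete energies and sequence norms\<close>

definition cell_avg ::
    "('i \<Rightarrow> 'a \<Rightarrow> 'a) \<Rightarrow> 'a set \<Rightarrow> 'a measure \<Rightarrow> ('a \<Rightarrow> real) \<Rightarrow> 'i list \<Rightarrow> real" where
  "cell_avg F L \<nu> f w = inverse (measure \<nu> (cell F L w)) * (LINT x:cell F L w|\<nu>. f x)"

definition disc_energy ::
    "('i \<Rightarrow> 'a \<Rightarrow> 'a) \<Rightarrow> 'a set \<Rightarrow> 'i set \<Rightarrow> 'i set \<Rightarrow> nat \<Rightarrow> nat \<Rightarrow> ('i list \<Rightarrow> real) \<Rightarrow> real" where
  "disc_energy F K W I M n g = (\<Sum>(v, w) \<in> {(v, w). linked F K W I M n v w}. (g v - g w)\<^sup>2)"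

definition near_energy :: "'a::metric_space set \<Rightarrow> 'a measure \<Rightarrow> real \<Rightarrow> ('a \<Rightarrow> real) \<Rightarrow> real" where
  "near_energy L \<nu> r f =
     (LINT z:{(x, y). x \<in> L \<and> y \<in> L \<and> dist x y < r}|(\<nu> \<Otimes>\<^sub>M \<nu>). \<bar>f (fst z) - f (snd z)\<bar>\<^sup>2)"

text \<open>The \<open>l\<^sup>q\<close> norm for \<open>1 \<le> q \<le> \<infinity>\<close>, with value \<open>\<infinity>\<close> for sequences not in \<open>l\<^sup>q\<close>.\<close>

definition lq_norm :: "ennreal \<Rightarrow> (nat \<Rightarrow> real) \<Rightarrow> ennreal" where
  "lq_norm q a =
     (if q = \<infinity> then (SUP n. ennreal \<bar>a n\<bar>)
      else let s = (\<Sum>n. ennreal (\<bar>a n\<bar> powr enn2real q))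
           in if s = \<infinity> then \<infinity> else ennreal (enn2real s powr (1 / enn2real q)))"

end

theory Submission
  imports Defs
begin

text \<open>Everything is transported along the coding map to the product measure \<open>P\<close> on \<open>I\<^sup>\<nat>\<close>, where cells
  become cylinders. This is legitimate because the cells of level \<open>n\<close> overlap in null sets only: if
  \<open>\<omega>\<close> is coded into a foreign cell with positive probability, then with positive probability this
  happens for infinitely many shifts of \<open>\<omega>\<close>, which gives the coded point infinitely many addresses,
  contrary to (A4).

  For \<open>h = f \<circ> \<pi>\<close> let \<open>J n\<close> be the integral of \<open>(h x - h y)\<^sup>2\<close> over the pairs with linked \<open>n\<close>-prefixes.
  By (A2), \<open>J n\<close> lies between the two integrals over neighbourhoods of the diagonal. Expanding the
  square gives \<open>J n\<close> as \<open>E n / N^(2n)\<close>, with \<open>E n\<close> the discrete energy of the averages, plus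
  nonnegative variances over the cells. Dropping the variances yields the upper bound. By (A1) they
  contribute at most a multiple of \<open>r n / N^n\<close>, where \<open>r n\<close> is the squared distance of \<open>h\<close> to the
  functions of \<open>n\<close> letters. Now \<open>r n\<close> tends to \<open>0\<close>, and \<open>r n - r (n + 1)\<close> is at most a multiple of
  \<open>E (n + 1) / N^(n + 1)\<close> because siblings are joined by chains of links. As \<open>\<beta> > 0\<close>, a discrete
  Hardy inequality finishes the proof.\<close>

section \<open>Sequence norms\<close>

lemma lq_norm_mono:
  assumes "1 \<le> q" "\<And>n. \<bar>a n\<bar> \<le> \<bar>b n\<bar>"
  shows "lq_norm q a \<le> lq_norm q b"
proof (cases "q = \<infinity>")
  case True
  then show ?thesis
    using assms(2) by (auto simp: lq_norm_def intro!: SUP_mono ennreal_leI)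
next
  case False
  define p where "p = enn2real q"
  have p: "p \<ge> 1"
    using assms(1) False unfolding p_def by (cases q) auto
  have le: "(\<Sum>n. ennreal (\<bar>a n\<bar> powr p)) \<le> (\<Sum>n. ennreal (\<bar>b n\<bar> powr p))"
    using assms(2) p by (intro suminf_le summableI ennreal_leI powr_mono2) auto
  show ?thesis
  proof (cases "(\<Sum>n. ennreal (\<bar>b n\<bar> powr p)) = \<infinity>")
    case True
    then show ?thesis using False by (simp add: lq_norm_def p_def)
  next
    case fin: False
    then have "(\<Sum>n. ennreal (\<bar>a n\<bar> powr p)) \<noteq> \<infinity>"
      using le by (auto simp: top_unique)
    moreover have "enn2real (\<Sum>n. ennreal (\<bar>a n\<bar> powr p)) \<le> enn2real (\<Sum>n. ennreal (\<bar>b n\<bar> powr p))"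
      using le fin by (intro enn2real_mono) (auto simp: less_top)
    ultimately show ?thesis
      using fin False p by (auto simp: lq_norm_def p_def intro!: ennreal_leI powr_mono2)
  qed
qed

lemma lq_norm_cmult:
  assumes "1 \<le> q" "0 < c"
  shows "lq_norm q (\<lambda>n. c * a n) = ennreal c * lq_norm q a"
proof (cases "q = \<infinity>")
  case True
  then show ?thesis
    using assms(2) by (simp add: lq_norm_def abs_mult ennreal_mult SUP_mult_left_ennreal)
next
  case False
  define p where "p = enn2real q"
  have p: "p \<ge> 1"
    using assms(1) False unfolding p_def by (cases q) auto
  have eq: "(\<Sum>n. ennreal (\<bar>c * a n\<bar> powr p)) = ennreal (c powr p) * (\<Sum>n. ennreal (\<bar>a n\<bar> powr p))"
    using assms(2) by (simp add: abs_mult powr_mult ennreal_mult)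
  show ?thesis
  proof (cases "(\<Sum>n. ennreal (\<bar>a n\<bar> powr p)) = \<infinity>")
    case True
    moreover have "ennreal (c powr p) * \<infinity> = \<infinity>"
      using assms(2) by (simp add: ennreal_mult_top)
    moreover have "ennreal c * \<infinity> = \<infinity>"
      using assms(2) by (simp add: ennreal_mult_top)
    ultimately show ?thesis using False
      unfolding lq_norm_def p_def[symmetric] eq by simp
  next
    case fin: False
    then have "ennreal (c powr p) * (\<Sum>n. ennreal (\<bar>a n\<bar> powr p)) \<noteq> \<infinity>"
      by (simp add: ennreal_mult_eq_top_iff)
    moreover have "(enn2real (ennreal (c powr p) * (\<Sum>n. ennreal (\<bar>a n\<bar> powr p)))) powr (1/p)
        = c * enn2real (\<Sum>n. ennreal (\<bar>a n\<bar> powr p)) powr (1/p)"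
      using assms(2) p by (simp add: enn2real_mult powr_mult powr_powr)
    ultimately show ?thesis
      using fin False assms(2)
      unfolding lq_norm_def p_def[symmetric] eq Let_def by (simp add: ennreal_mult)
  qed
qed

text \<open>Convexity of \<open>t powr p\<close> on the closed half-line. For two positive arguments
  this is convexity on the open half-line; if one argument is 0, the claim reduces to
  \<open>t powr p \<le> t\<close> for \<open>0 < t < 1\<close>.\<close>

lemma powr_convex_combination:
  fixes x y r p :: real
  assumes "0 \<le> x" "0 \<le> y" "0 < r" "r < 1" "1 \<le> p"
  shows "((1 - r) * x + r * y) powr p \<le> (1 - r) * x powr p + r * y powr p"
proof -
  have le: "(t * u) powr p \<le> t * u powr p" if "0 < t" "t < 1" "0 \<le> u" for t u :: real
  proof -
    have "t powr p \<le> t powr 1"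
      using that assms(5) by (intro powr_mono') auto
    then have "t powr p * u powr p \<le> t * u powr p"
      using that by (intro mult_right_mono) auto
    then show ?thesis
      using that by (simp add: powr_mult)
  qed
  consider "x = 0" | "y = 0" | "x > 0" "y > 0"
    using assms by linarith
  then show ?thesis
  proof cases
    case 1
    then show ?thesis using le[of r y] assms by simp
  next
    case 2
    then show ?thesis using le[of "1 - r" x] assms by simp
  next
    case 3
    then show ?thesis
      using convex_onD[OF powr_convex[OF assms(5)], of r x y] assms by simp
  qed
qed

text \<open>Applying the recursion \<open>k\<close> times leaves the remainder
  \<open>r ^ k * T (n + k)\<close> and a geometric sum of the bound \<open>A\<close>;
  \<open>lim\<close> removes the remainder. This settles the supremum norm below and serves as an a
  priori bound for finite exponents.\<close>

lemma backward_recursion_bounded: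
  fixes T a :: "nat \<Rightarrow> real"
  assumes r: "0 < r" "r < 1" and C: "0 < C"
    and rec: "\<And>n. T n \<le> r * T (Suc n) + C * a n"
    and lim: "(\<lambda>k. r ^ k * T k) \<longlonglongrightarrow> 0"
    and bd: "\<And>n. a n \<le> A"
  shows "T n \<le> C / (1 - r) * A"
proof -
  have it: "T n \<le> r ^ k * T (n + k) + (1 - r ^ k) * (C / (1 - r) * A)" for k
  proof (induction k)
    case (Suc k)
    have "T (n + k) \<le> r * T (n + Suc k) + C * A"
      using rec[of "n + k"] bd[of "n + k"] C by (simp add: order_trans mult_left_mono add_left_mono)
    then have "r ^ k * T (n + k) \<le> r ^ k * (r * T (n + Suc k) + C * A)"
      using r by (intro mult_left_mono) auto
    moreover have "r ^ k * (C * A) + (1 - r ^ k) * (C / (1 - r) * A)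
        = (1 - r ^ Suc k) * (C / (1 - r) * A)"
      using r by (simp add: field_simps)
    ultimately show ?case
      using Suc by (simp add: algebra_simps)
  qed simp
  \<comment> \<open>In \<open>lim\<close> the power of \<open>r\<close> matches the full index
    \<open>k + n\<close>, so \<open>r ^ n\<close> has to be divided out.\<close>
  have "(\<lambda>k. inverse (r ^ n) * (r ^ (k + n) * T (k + n))) \<longlonglongrightarrow> inverse (r ^ n) * 0"
    by (intro tendsto_mult tendsto_const LIMSEQ_ignore_initial_segment[OF lim])
  then have "(\<lambda>k. r ^ k * T (n + k)) \<longlonglongrightarrow> 0"
    using r by (simp add: power_add add.commute field_simps)
  moreover have "(\<lambda>k. r ^ k) \<longlonglongrightarrow> 0"
    using r by (intro LIMSEQ_realpow_zero) auto
  ultimately have "(\<lambda>k. r ^ k * T (n + k) + (1 - r ^ k) * (C / (1 - r) * A))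
      \<longlonglongrightarrow> 0 + (1 - 0) * (C / (1 - r) * A)"
    by (intro tendsto_add tendsto_mult tendsto_diff tendsto_const)
  then show ?thesis
    using it by (intro LIMSEQ_le_const[of _ "C / (1 - r) * A"]) auto
qed

text \<open>A discrete Hardy inequality, in a form that avoids the sums \<open>\<Sum>k. r ^ k * a (n + k)\<close>.\<close>

lemma lq_norm_backward_recursion:
  fixes T a :: "nat \<Rightarrow> real"
  assumes q: "1 \<le> q" and r: "0 < r" "r < 1" and C: "0 < C"
    and nonneg: "\<And>n. 0 \<le> T n" "\<And>n. 0 \<le> a n"
    and rec: "\<And>n. T n \<le> r * T (Suc n) + C * a n"
    and lim: "bounded (range a) \<Longrightarrow> (\<lambda>k. r ^ k * T k) \<longlonglongrightarrow> 0"
  shows "lq_norm q T \<le> ennreal (C / (1 - r)) * lq_norm q a"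
proof (cases "lq_norm q a = \<infinity>")
  case True
  have "ennreal (C / (1 - r)) * lq_norm q a = \<infinity>"
    using True r C by (simp add: ennreal_mult_top)
  then show ?thesis by simp
next
  case fin: False
  show ?thesis
  proof (cases "q = \<infinity>")
    case True
    define A where "A = enn2real (lq_norm q a)"
    have A: "ennreal A = (SUP n. ennreal (a n))"
    proof -
      have "ennreal A = lq_norm q a"
        using fin unfolding A_def by (intro ennreal_enn2real) (simp add: less_top)
      also have "\<dots> = (SUP n. ennreal (a n))"
        using True nonneg by (simp add: lq_norm_def)
      finally show ?thesis .
    qed
    have le: "a n \<le> A" for n
    proof -
      have "ennreal (a n) \<le> ennreal A" unfolding A by (rule SUP_upper) simp
      then show ?thesis using nonneg(2) by (simp add: A_def)
    qed
    then have "bounded (range a)"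
      using nonneg by (intro boundedI[of _ A]) auto
    then have "T n \<le> C / (1 - r) * A" for n
      using backward_recursion_bounded[OF r C rec lim le] by blast
    then have "lq_norm q T \<le> ennreal (C / (1 - r) * A)"
      using True nonneg by (auto simp: lq_norm_def intro!: SUP_least ennreal_leI)
    also have "\<dots> = ennreal (C / (1 - r)) * lq_norm q a"
      using r C fin unfolding A_def by (subst ennreal_mult) (auto simp: less_top)
    finally show ?thesis .
  next
    case False
    define p where "p = enn2real q"
    have p: "p \<ge> 1"
      using q False unfolding p_def by (cases q) auto
    \<comment> \<open>With this scaling the recursion reads
      \<open>T n \<le> (1 - r) * x n + r * T (Suc n)\<close>, a convex combination, so
      \<open>p\<close>-th powers can be taken without losing a constant.\<close>
    define x where "x n = C / (1 - r) * a n" for n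
    define y where "y n = T n powr p" for n
    define z where "z n = x n powr p" for n
    have x0: "x n \<ge> 0" for n using nonneg r C by (simp add: x_def)
    have pos: "C / (1 - r) > 0" using r C by simp
    have lqx: "lq_norm q x = ennreal (C / (1 - r)) * lq_norm q a"
      unfolding x_def by (rule lq_norm_cmult[OF q pos])
    then have "lq_norm q x \<noteq> \<infinity>"
      using fin by (simp add: ennreal_mult_eq_top_iff)
    then have zfin: "(\<Sum>n. ennreal (z n)) \<noteq> \<infinity>"
    proof (rule contrapos_nn)
      assume "(\<Sum>n. ennreal (z n)) = \<infinity>"
      then show "lq_norm q x = \<infinity>"
        using False x0 by (simp add: lq_norm_def z_def p_def)
    qed
    then have zs: "summable z"
      by (intro summable_suminf_not_top) (auto simp: z_def)
    define Z where "Z = suminf z"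
    have zZ: "(\<Sum>n<m. z n) \<le> Z" for m
      unfolding Z_def by (intro sum_le_suminf zs) (auto simp: z_def)
    have "z n \<le> Z" for n
      using sum_le_suminf[OF zs, of "{n}"] by (auto simp: Z_def z_def)
    then have xb: "x n \<le> Z powr (1 / p)" for n
    proof -
      have "(x n powr p) powr (1/p) \<le> Z powr (1 / p)"
        using \<open>z n \<le> Z\<close> p by (intro powr_mono2) (auto simp: z_def)
      then show ?thesis using x0 p by (simp add: powr_powr)
    qed
    have ab: "a n \<le> (1 - r) / C * Z powr (1 / p)" for n
      using xb[of n] r C by (simp add: x_def field_simps)
    then have "bounded (range a)"
      using nonneg by (intro boundedI[of _ "(1 - r) / C * Z powr (1 / p)"]) auto
    then have "T n \<le> C / (1 - r) * ((1 - r) / C * Z powr (1 / p))" for n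
      using backward_recursion_bounded[OF r C rec lim ab] by blast
    then have Tb: "T n \<le> Z powr (1 / p)" for n
      using r C by simp
    have Z0: "Z \<ge> 0" using zZ[of 0] by simp
    have yb: "y n \<le> Z" for n
    proof -
      have "T n powr p \<le> (Z powr (1 / p)) powr p"
        using Tb nonneg p by (intro powr_mono2) auto
      then show ?thesis using Z0 p by (simp add: powr_powr y_def)
    qed
    have yrec: "y n \<le> r * y (Suc n) + (1 - r) * z n" for n
    proof -
      have "T n \<le> (1 - r) * x n + r * T (Suc n)"
        using rec[of n] r by (simp add: x_def)
      then have "y n \<le> ((1 - r) * x n + r * T (Suc n)) powr p"
        unfolding y_def using nonneg p by (intro powr_mono2) auto
      also have "\<dots> \<le> (1 - r) * x n powr p + r * T (Suc n) powr p"
        using nonneg x0 r p by (intro powr_convex_combination) auto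
      finally show ?thesis by (simp add: y_def z_def)
    qed
    have y0: "0 \<le> y 0" by (simp add: y_def)
    \<comment> \<open>The shifted sum loses \<open>y 0\<close> and gains one new term, which is at
      most \<open>Z\<close> by the pointwise bound \<open>yb\<close>.\<close>
    have shift: "(\<Sum>n<m. y (Suc n)) \<le> (\<Sum>n<m. y n) + Z" for m
    proof -
      have "(\<Sum>n<m. y (Suc n)) = (\<Sum>n<Suc m. y n) - y 0"
        by (subst sum.lessThan_Suc_shift) simp
      also have "\<dots> \<le> (\<Sum>n<m. y n) + Z"
        using yb[of m] y0 by simp
      finally show ?thesis .
    qed
    have part: "(\<Sum>n<m. y n) \<le> r * (\<Sum>n<m. y (Suc n)) + (1 - r) * Z" for m
    proof -
      have "(\<Sum>n<m. y n) \<le> (\<Sum>n<m. r * y (Suc n) + (1 - r) * z n)"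
        by (intro sum_mono yrec)
      also have "\<dots> = r * (\<Sum>n<m. y (Suc n)) + (1 - r) * (\<Sum>n<m. z n)"
        by (simp add: sum.distrib sum_distrib_left)
      also have "\<dots> \<le> r * (\<Sum>n<m. y (Suc n)) + (1 - r) * Z"
        using zZ r by (intro add_left_mono mult_left_mono) auto
      finally show ?thesis .
    qed
    \<comment> \<open>This crude bound serves to make \<open>y\<close> summable. The sharp bound
      \<open>suminf y \<le> Z\<close> comes from the same recursion for the infinite sums, where
      \<open>r * suminf y\<close> can be absorbed once it is known to be finite.\<close>
    have "(\<Sum>n<m. y n) \<le> Z / (1 - r)" for m
    proof -
      have "(\<Sum>n<m. y n) \<le> r * ((\<Sum>n<m. y n) + Z) + (1 - r) * Z"
        using part[of m] mult_left_mono[OF shift[of m], of r] r by linarith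
      then show ?thesis using r by (simp add: field_simps)
    qed
    then have ys: "summable y"
      by (intro summableI_nonneg_bounded[of _ "Z / (1 - r)"]) (auto simp: y_def)
    have "suminf y \<le> Z"
    proof -
      have "(\<Sum>n. y (Suc n)) \<le> suminf y"
        using suminf_split_head[OF ys] by (simp add: y_def)
      moreover have "suminf y \<le> (\<Sum>n. r * y (Suc n) + (1 - r) * z n)"
        using ys zs by (intro suminf_le yrec ys summable_add summable_mult) (auto simp: summable_Suc_iff)
      moreover have "(\<Sum>n. r * y (Suc n) + (1 - r) * z n) = r * (\<Sum>n. y (Suc n)) + (1 - r) * Z"
      proof -
        have ys': "summable (\<lambda>n. y (Suc n))" using ys by (simp add: summable_Suc_iff)
        show ?thesis
          unfolding Z_def suminf_mult[OF ys', symmetric] suminf_mult[OF zs, symmetric]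
          by (intro suminf_add[symmetric] summable_mult ys' zs)
      qed
      ultimately have "suminf y \<le> r * suminf y + (1 - r) * Z"
        using mult_left_mono[of "\<Sum>n. y (Suc n)" "suminf y" r] r by linarith
      then have "(1 - r) * suminf y \<le> (1 - r) * Z" by (simp add: algebra_simps)
      then show ?thesis using r by simp
    qed
    moreover have "suminf y \<ge> 0"
      by (intro suminf_nonneg ys) (auto simp: y_def)
    moreover have "(\<Sum>n. ennreal (y n)) = ennreal (suminf y)" "(\<Sum>n. ennreal (z n)) = ennreal Z"
      unfolding Z_def by (intro suminf_ennreal2 ys zs; simp add: y_def z_def)+
    ultimately have "lq_norm q T \<le> lq_norm q x"
      using False nonneg x0 p Z0
      by (auto simp: lq_norm_def p_def[symmetric] y_def[symmetric] z_def[symmetric] intro!: ennreal_leI powr_mono2)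
    then show ?thesis unfolding lqx .
  qed
qed

section \<open>Words and Bernoulli measures\<close>

lemma words_0 [simp]: "words A 0 = {[]}"
  by (auto simp: words_def)

lemma length_words: "w \<in> words A n \<Longrightarrow> length w = n"
  by (simp add: words_def)

lemma finite_words [simp]: "finite A \<Longrightarrow> finite (words A n)"
  using finite_lists_length_eq[of A n] by (simp add: words_def)

lemma append_mem_words: "u \<in> words A m \<Longrightarrow> v \<in> words A n \<Longrightarrow> u @ v \<in> words A (m + n)"
  by (auto simp: words_def)

lemma snoc_mem_words: "u \<in> words A n \<Longrightarrow> i \<in> A \<Longrightarrow> u @ [i] \<in> words A (Suc n)"
  by (auto simp: words_def)

lemma prefix_mem_words: "range \<omega> \<subseteq> A \<Longrightarrow> map \<omega> [0..<n] \<in> words A n"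
  by (auto simp: words_def)

lemma sum_words_Suc: "(\<Sum>w\<in>words A (Suc n). f w) = (\<Sum>u\<in>words A n. \<Sum>i\<in>A. f (u @ [i]))"
proof -
  have "bij_betw (\<lambda>(u, i). u @ [i]) (words A n \<times> A) (words A (Suc n))"
  proof (rule bij_betw_imageI)
    show "inj_on (\<lambda>(u, i). u @ [i]) (words A n \<times> A)"
      by (auto simp: inj_on_def)
    have "w \<in> (\<lambda>(u, i). u @ [i]) ` (words A n \<times> A)" if "w \<in> words A (Suc n)" for w
    proof -
      have "w = butlast w @ [last w]" "butlast w \<in> words A n" "last w \<in> A"
        using that by (cases w rule: rev_cases; auto simp: words_def)+
      then show ?thesis by force
    qed
    then show "(\<lambda>(u, i). u @ [i]) ` (words A n \<times> A) = words A (Suc n)"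
      by (auto simp: words_def)
  qed
  from sum.reindex_bij_betw[OF this, of f, symmetric] show ?thesis
    by (simp add: sum.cartesian_product case_prod_unfold)
qed

lemma prefix_eq_iff: "length w = n \<Longrightarrow> map \<omega> [0..<n] = w \<longleftrightarrow> (\<forall>i<n. \<omega> i = w ! i)"
  by (simp add: list_eq_iff_nth_eq)

lemma take_prefix: "take m (map \<omega> [0..<n]) = map \<omega> [0..<min m n]"
  by (simp add: take_map min_def)

definition cyl :: "'i set \<Rightarrow> 'i list \<Rightarrow> (nat \<Rightarrow> 'i) set" where
  "cyl A w = {\<omega>. range \<omega> \<subseteq> A \<and> map \<omega> [0..<length w] = w}"

lemma indicator_cyl: "range \<omega> \<subseteq> A \<Longrightarrow> w \<in> words A n \<Longrightarrow>
    indicator (cyl A w) \<omega> = (if w = map \<omega> [0..<n] then 1 else (0::real))"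
  by (auto simp: cyl_def indicator_def length_words)

lemma indicator_cyl_snoc:
  assumes "range \<omega> \<subseteq> A" "finite A"
  shows "indicator (cyl A w) \<omega> = (\<Sum>i\<in>A. indicator (cyl A (w @ [i])) \<omega> :: real)"
proof -
  have "indicator (cyl A (w @ [i])) \<omega> = (if i = \<omega> (length w) then indicator (cyl A w) \<omega> else (0::real))" for i
    by (auto simp: cyl_def indicator_def)
  then show ?thesis using assms by auto
qed

section \<open>The uniform Bernoulli measure, its cylinders and its shift invariance\<close>

locale bernoulli =
  fixes A :: "'i set"
  assumes finite_A: "finite A" and A_nonempty: "A \<noteq> {}"
begin

abbreviation P :: "(nat \<Rightarrow> 'i) measure" where
  "P \<equiv> PiM UNIV (\<lambda>_. uniform_count_measure A)"

abbreviation N :: real where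
  "N \<equiv> real (card A)"

lemma N_ge_1: "N \<ge> 1"
  using finite_A A_nonempty by (simp add: Suc_le_eq card_gt_0_iff)

lemma N_pos: "N > 0"
  using N_ge_1 by linarith

sublocale prob_space P
  by (intro prob_space_PiM prob_space_uniform_count_measure finite_A A_nonempty)

sublocale PP: pair_prob_space P P ..

lemma space_P: "space P = {\<omega>. range \<omega> \<subseteq> A}"
  by (auto simp: space_PiM PiE_UNIV_domain space_uniform_count_measure)

lemma prefix_measurable [measurable]:
  "(\<lambda>\<omega>. map \<omega> [0..<n]) \<in> measurable P (count_space (words A n))"
proof -
  have "(\<lambda>\<omega>. map \<omega> [0..<n]) -` {w} \<inter> space P \<in> sets P" if "w \<in> words A n" for w
  proof -
    have "(\<lambda>\<omega>. map \<omega> [0..<n]) -` {w} \<inter> space P = {\<omega> \<in> space P. \<forall>i\<in>{..<n}. \<omega> i \<in> {w ! i}}"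
      using prefix_eq_iff[OF length_words[OF that]] by auto
    also have "\<dots> \<in> sets P"
    proof (rule sets.sets_Collect_finite_All)
      fix i assume "i \<in> {..<n}"
      then have "{w ! i} \<in> sets (uniform_count_measure A)"
        using that by (auto simp: words_def sets_uniform_count_measure subset_iff)
      then show "{\<omega> \<in> space P. \<omega> i \<in> {w ! i}} \<in> sets P"
        by measurable
    qed auto
    finally show ?thesis .
  qed
  then show ?thesis
    using finite_A by (subst measurable_count_space_eq2) (auto simp: space_P prefix_mem_words)
qed

lemma prefix_fun_measurable: "(\<lambda>\<omega>. c (map \<omega> [0..<n])) \<in> borel_measurable P"
  by (rule measurable_compose[OF prefix_measurable]) auto

lemma cyl_eq: "w \<in> words A n \<Longrightarrow> cyl A w = {\<omega> \<in> space P. map \<omega> [0..<n] = w}"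
  by (auto simp: cyl_def space_P length_words)

lemma sets_cyl: "w \<in> words A n \<Longrightarrow> cyl A w \<in> sets P"
proof -
  assume w: "w \<in> words A n"
  have "(\<lambda>\<omega>. map \<omega> [0..<n]) -` {w} \<inter> space P \<in> sets P"
    using w by (intro measurable_sets[OF prefix_measurable]) auto
  moreover have "cyl A w = (\<lambda>\<omega>. map \<omega> [0..<n]) -` {w} \<inter> space P"
    unfolding cyl_eq[OF w] by blast
  ultimately show ?thesis by simp
qed

lemma measure_cyl:
  assumes w: "w \<in> words A n"
  shows "measure P (cyl A w) = 1 / N ^ n"
proof -
  interpret U: prob_space "uniform_count_measure A"
    by (rule prob_space_uniform_count_measure[OF finite_A A_nonempty])
  interpret C: product_prob_space "\<lambda>_. uniform_count_measure A" "UNIV :: nat set"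
    by unfold_locales
  have "cyl A w = {\<omega> \<in> space P. \<forall>i\<in>{..<n}. \<omega> i \<in> {w ! i}}"
    unfolding cyl_eq[OF w] using prefix_eq_iff[OF length_words[OF w]] by auto
  also have "emeasure P \<dots> = (\<Prod>i<n. emeasure (uniform_count_measure A) {w ! i})"
    using w by (intro C.emeasure_PiM_Collect) (auto simp: words_def sets_uniform_count_measure subset_iff)
  also have "\<dots> = (\<Prod>i<n. ennreal (1 / N))"
    using w finite_A A_nonempty
    by (intro prod.cong) (auto simp: words_def emeasure_uniform_count_measure subset_iff)
  also have "\<dots> = ennreal (1 / N ^ n)"
    by (simp add: ennreal_power power_one_over)
  finally show ?thesis
    by (simp add: measure_def)
qed

text \<open>The coordinates are independent and identically distributed, so reindexing along the
  injection \<open>(+) k\<close> reproduces \<open>P\<close>.\<close>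

lemma distr_shift: "distr P P (\<lambda>\<omega> n. \<omega> (k + n)) = P"
  using distr_PiM_reindex[of UNIV "\<lambda>_. uniform_count_measure A" "(+) k" UNIV]
    prob_space_uniform_count_measure[OF finite_A A_nonempty]
  by (simp add: restrict_UNIV)

lemma shift_measurable [measurable]: "(\<lambda>\<omega> n. \<omega> (k + n)) \<in> measurable P P"
proof (rule measurable_PiM_single')
  show "(\<lambda>\<omega> n. \<omega> (k + n)) \<in> space P \<rightarrow> (\<Pi>\<^sub>E i\<in>UNIV. space (uniform_count_measure A))"
    by (simp add: space_P PiE_UNIV_domain space_uniform_count_measure image_subset_iff)
qed measurable

text \<open>Since \<open>P\<close> is shift invariant, Fatou's lemma bounds \<open>P (limsup)\<close> of the shifted events from
  below by \<open>P B\<close>; no ergodicity is needed.\<close>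

lemma null_if_null_recurrence:
  assumes B [measurable]: "B \<in> sets P"
    and null: "{\<omega> \<in> space P. infinite {k. (\<lambda>n. \<omega> (k + n)) \<in> B}} \<subseteq> Z" "Z \<in> null_sets P"
  shows "B \<in> null_sets P"
proof -
  define D where "D k = (\<lambda>\<omega> n. \<omega> (k + n)) -` B \<inter> space P" for k
  have D [measurable]: "D k \<in> sets P" for k
    unfolding D_def by measurable
  have PD: "measure P (D k) = measure P B" for k
    unfolding D_def by (subst measure_distr[symmetric, of _ P P]) (auto simp: distr_shift)
  define U where "U m = (\<Union>k\<in>{m..}. D k)" for m :: nat
  have U [measurable]: "U m \<in> sets P" for m
    unfolding U_def by measurable
  have "decseq U"
    by (force simp: decseq_def U_def)
  then have lim: "(\<lambda>m. measure P (U m)) \<longlonglongrightarrow> measure P (\<Inter>m. U m)"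
    by (intro finite_Lim_measure_decseq) auto
  have "measure P B \<le> measure P (U m)" for m
    unfolding PD[of m, symmetric] by (intro finite_measure_mono) (auto simp: U_def)
  then have le: "measure P B \<le> measure P (\<Inter>m. U m)"
    by (intro LIMSEQ_le_const[OF lim]) auto
  \<comment> \<open>A sequence lying in every tail union \<open>U m\<close> has infinitely many
    shifts in \<open>B\<close>.\<close>
  have "(\<Inter>m. U m) \<subseteq> {\<omega> \<in> space P. infinite {k. (\<lambda>n. \<omega> (k + n)) \<in> B}}"
    unfolding U_def D_def infinite_nat_iff_unbounded_le by auto
  also note null(1)
  finally have "(\<Inter>m. U m) \<in> null_sets P"
    using null(2) by (rule null_sets_subset[rotated 2]) measurable
  then have "measure P (\<Inter>m. U m) = 0"
    by (simp add: measure_eq_0_null_sets)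
  then have "measure P B = 0"
    using le measure_nonneg[of P B] by linarith
  then show ?thesis
    by (auto simp: null_sets_def emeasure_eq_measure)
qed

section \<open>Square integrable functions and their means over cylinders\<close>

lemma L2_measurable: "h \<in> L2 P \<Longrightarrow> h \<in> borel_measurable P"
  by (simp add: L2_def)

lemma L2_integrable_mult:
  assumes "f \<in> L2 P" "g \<in> L2 P"
  shows "integrable P (\<lambda>x. f x * g x)"
proof (rule Bochner_Integration.integrable_bound)
  show "integrable P (\<lambda>x. (f x)\<^sup>2 + (g x)\<^sup>2)"
    using assms by (auto simp: L2_def)
  show "(\<lambda>x. f x * g x) \<in> borel_measurable P"
    using assms by (auto simp: L2_def)
  have "\<bar>a * b\<bar> \<le> a\<^sup>2 + b\<^sup>2" for a b :: real
  proof -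
    have "2 * \<bar>a * b\<bar> \<le> a\<^sup>2 + b\<^sup>2"
      using sum_squares_bound[of "\<bar>a\<bar>" "\<bar>b\<bar>"] by (simp add: abs_mult mult.assoc)
    then show ?thesis by linarith
  qed
  then show "AE x in P. norm (f x * g x) \<le> norm ((f x)\<^sup>2 + (g x)\<^sup>2)"
    by (intro AE_I2) (simp add: abs_of_nonneg)
qed

lemma L2_bounded:
  assumes "h \<in> borel_measurable P" "\<And>x. x \<in> space P \<Longrightarrow> \<bar>h x\<bar> \<le> c"
  shows "h \<in> L2 P"
proof -
  have "integrable P (\<lambda>x. (h x)\<^sup>2)"
  proof (rule integrable_const_bound[of _ "c\<^sup>2"])
    show "AE x in P. norm ((h x)\<^sup>2) \<le> c\<^sup>2"
      using power_mono[OF assms(2), of _ 2] by (intro AE_I2) simp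
  qed (use assms(1) in measurable)
  then show ?thesis using assms(1) by (simp add: L2_def)
qed

lemma L2_integrable: "h \<in> L2 P \<Longrightarrow> integrable P h"
  using L2_integrable_mult[of h "\<lambda>_. 1"] L2_bounded[of "\<lambda>_. 1" 1] by auto

lemma L2_add:
  assumes "f \<in> L2 P" "g \<in> L2 P"
  shows "(\<lambda>x. f x + g x) \<in> L2 P"
  using assms L2_integrable_mult[OF assms] by (auto simp: L2_def power2_sum mult.assoc)

lemma L2_cmult: "f \<in> L2 P \<Longrightarrow> (\<lambda>x. c * f x) \<in> L2 P"
  by (auto simp: L2_def power_mult_distrib)

lemma L2_diff:
  assumes "f \<in> L2 P" "g \<in> L2 P"
  shows "(\<lambda>x. f x - g x) \<in> L2 P"
  using L2_add[OF assms(1) L2_cmult[OF assms(2), of "-1"]] by simp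

lemma L2_prefix_fun: "(\<lambda>\<omega>. c (map \<omega> [0..<n])) \<in> L2 P" for c :: "'i list \<Rightarrow> real"
proof (rule L2_bounded)
  show "(\<lambda>\<omega>. c (map \<omega> [0..<n])) \<in> borel_measurable P"
    by (rule prefix_fun_measurable)
  fix \<omega> assume "\<omega> \<in> space P"
  then show "\<bar>c (map \<omega> [0..<n])\<bar> \<le> Max ((\<lambda>w. \<bar>c w\<bar>) ` words A n)"
    using finite_A by (intro Max_ge) (auto simp: space_P prefix_mem_words)
qed

text \<open>Not normalised: a cylinder of length \<open>n\<close> has probability
  \<open>1 / N ^ n\<close>, so the mean of \<open>h\<close> over it is
  \<open>N ^ n * mass h w\<close>.\<close>

definition mass :: "((nat \<Rightarrow> 'i) \<Rightarrow> real) \<Rightarrow> 'i list \<Rightarrow> real" where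
  "mass h w = (LINT \<omega>|P. indicator (cyl A w) \<omega> * h \<omega>)"

text \<open>The squared \<open>L\<^sup>2\<close> distance from \<open>h\<close> to the functions of the first \<open>n\<close> letters.\<close>

definition resid :: "((nat \<Rightarrow> 'i) \<Rightarrow> real) \<Rightarrow> nat \<Rightarrow> real" where
  "resid h n = (LINT \<omega>|P. (h \<omega>)\<^sup>2) - N ^ n * (\<Sum>w\<in>words A n. (mass h w)\<^sup>2)"

lemma integrable_cyl:
  assumes "w \<in> words A n" "integrable P h"
  shows "integrable P (\<lambda>\<omega>. indicator (cyl A w) \<omega> * h \<omega> :: real)"
  using integrable_mult_indicator[OF sets_cyl[OF assms(1)] assms(2)] by simp

lemma mass_add: "w \<in> words A n \<Longrightarrow> integrable P f \<Longrightarrow> integrable P g \<Longrightarrow>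
    mass (\<lambda>\<omega>. f \<omega> + g \<omega>) w = mass f w + mass g w"
  unfolding mass_def by (simp add: distrib_left integrable_cyl)

lemma mass_diff: "w \<in> words A n \<Longrightarrow> integrable P f \<Longrightarrow> integrable P g \<Longrightarrow>
    mass (\<lambda>\<omega>. f \<omega> - g \<omega>) w = mass f w - mass g w"
  unfolding mass_def by (simp add: right_diff_distrib integrable_cyl)

lemma mass_cmult: "mass (\<lambda>\<omega>. c * f \<omega>) w = c * mass f w"
  unfolding mass_def by (simp add: mult.left_commute)

lemma mass_const: "w \<in> words A n \<Longrightarrow> mass (\<lambda>_. c) w = c / N ^ n"
  unfolding mass_def using measure_cyl sets.Int_space_eq2[OF sets_cyl] by simp

lemma mass_snoc:
  assumes "w \<in> words A n" "integrable P h"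
  shows "mass h w = (\<Sum>i\<in>A. mass h (w @ [i]))"
proof -
  have "mass h w = (LINT \<omega>|P. (\<Sum>i\<in>A. indicator (cyl A (w @ [i])) \<omega> * h \<omega>))"
    unfolding mass_def using finite_A
    by (intro Bochner_Integration.integral_cong) (auto simp: space_P indicator_cyl_snoc sum_distrib_right)
  also have "\<dots> = (\<Sum>i\<in>A. mass h (w @ [i]))"
    unfolding mass_def using assms
    by (intro Bochner_Integration.integral_sum integrable_cyl[OF snoc_mem_words]) auto
  finally show ?thesis .
qed

lemma integral_eq_sum_mass:
  assumes "integrable P h"
  shows "(LINT \<omega>|P. h \<omega>) = (\<Sum>w\<in>words A n. mass h w)"
proof (induction n)
  case 0
  have "mass h [] = (LINT \<omega>|P. h \<omega>)"
    unfolding mass_def by (intro Bochner_Integration.integral_cong) (auto simp: cyl_def space_P indicator_def)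
  then show ?case by simp
next
  case (Suc n)
  then show ?case
    unfolding sum_words_Suc using mass_snoc[OF _ assms] by simp
qed

text \<open>Localises the residual: the summands are the cellwise variances that reappear in
  \<open>pair_energy_eq\<close>.\<close>

lemma resid_eq_sum:
  assumes "h \<in> L2 P"
  shows "resid h n = (\<Sum>w\<in>words A n. mass (\<lambda>\<omega>. (h \<omega>)\<^sup>2) w - N ^ n * (mass h w)\<^sup>2)"
  unfolding resid_def using assms
  by (subst integral_eq_sum_mass[of _ n]) (auto simp: L2_def sum_subtractf sum_distrib_left)

lemma mass_square_diff:
  assumes h: "h \<in> L2 P" and w: "w \<in> words A n"
  shows "mass (\<lambda>\<omega>. (h \<omega> - c)\<^sup>2) w = mass (\<lambda>\<omega>. (h \<omega>)\<^sup>2) w - 2 * c * mass h w + c\<^sup>2 / N ^ n"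
proof -
  have "(\<lambda>\<omega>. (h \<omega> - c)\<^sup>2) = (\<lambda>\<omega>. ((h \<omega>)\<^sup>2 - (2 * c) * h \<omega>) + c\<^sup>2)"
    by (auto simp: power2_diff algebra_simps)
  then have "mass (\<lambda>\<omega>. (h \<omega> - c)\<^sup>2) w = mass (\<lambda>\<omega>. ((h \<omega>)\<^sup>2 - (2 * c) * h \<omega>) + c\<^sup>2) w"
    by simp
  also have "\<dots> = mass (\<lambda>\<omega>. (h \<omega>)\<^sup>2) w - (2 * c) * mass h w + c\<^sup>2 / N ^ n"
    using h L2_integrable[OF h] w
    by (subst mass_add, simp_all add: L2_def, subst mass_diff) (auto simp: mass_cmult mass_const L2_def)
  finally show ?thesis .
qed

lemma mass_nonneg: "(\<And>\<omega>. 0 \<le> f \<omega>) \<Longrightarrow> 0 \<le> mass f w"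
  unfolding mass_def by (intro integral_nonneg_AE AE_I2) auto

text \<open>The expression is the integral over the cylinder of the squared deviation of
  \<open>h\<close> from its mean \<open>N ^ n * mass h w\<close>.\<close>

lemma mass_variance_nonneg:
  assumes h: "h \<in> L2 P" and w: "w \<in> words A n"
  shows "0 \<le> mass (\<lambda>\<omega>. (h \<omega>)\<^sup>2) w - N ^ n * (mass h w)\<^sup>2"
proof -
  have "0 \<le> mass (\<lambda>\<omega>. (h \<omega> - N ^ n * mass h w)\<^sup>2) w"
    by (intro mass_nonneg) auto
  also have "\<dots> = mass (\<lambda>\<omega>. (h \<omega>)\<^sup>2) w - N ^ n * (mass h w)\<^sup>2"
    unfolding mass_square_diff[OF assms] using N_pos
    by (simp add: power_mult_distrib power2_eq_square field_simps)
  finally show ?thesis .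
qed

lemma resid_nonneg: "h \<in> L2 P \<Longrightarrow> 0 \<le> resid h n"
  unfolding resid_eq_sum by (intro sum_nonneg mass_variance_nonneg)

text \<open>On each cylinder the mean is the best constant in mean square; taking the value
  \<open>c w\<close> instead costs an extra square.\<close>

lemma resid_le:
  assumes h: "h \<in> L2 P"
  shows "resid h n \<le> (LINT \<omega>|P. (h \<omega> - c (map \<omega> [0..<n]))\<^sup>2)"
proof -
  have le: "mass (\<lambda>\<omega>. (h \<omega>)\<^sup>2) w - N ^ n * (mass h w)\<^sup>2
      \<le> mass (\<lambda>\<omega>. (h \<omega> - c (map \<omega> [0..<n]))\<^sup>2) w" if w: "w \<in> words A n" for w
  proof -
    have "mass (\<lambda>\<omega>. (h \<omega> - c (map \<omega> [0..<n]))\<^sup>2) w = mass (\<lambda>\<omega>. (h \<omega> - c w)\<^sup>2) w"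
      unfolding mass_def using w
      by (intro Bochner_Integration.integral_cong) (auto simp: cyl_def indicator_def length_words)
    \<comment> \<open>This square, which is \<open>1 / N ^ n\<close> times the squared distance from
      \<open>c w\<close> to the mean, is exactly that excess.\<close>
    moreover have "0 \<le> N ^ n * (mass h w - c w / N ^ n)\<^sup>2"
      using N_pos by simp
    then have "0 \<le> N ^ n * (mass h w)\<^sup>2 - 2 * c w * mass h w + (c w)\<^sup>2 / N ^ n"
    proof -
      have "N ^ n * (x - y / N ^ n)\<^sup>2 = N ^ n * x\<^sup>2 - 2 * y * x + y\<^sup>2 / N ^ n" for x y
        using N_pos by (simp add: power2_diff power2_eq_square field_simps)
      then show ?thesis
        using \<open>0 \<le> N ^ n * (mass h w - c w / N ^ n)\<^sup>2\<close> by (simp only:)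
    qed
    ultimately show ?thesis
      unfolding mass_square_diff[OF h w] by linarith
  qed
  have "integrable P (\<lambda>\<omega>. (h \<omega> - c (map \<omega> [0..<n]))\<^sup>2)"
    using L2_diff[OF h L2_prefix_fun] by (simp add: L2_def)
  then show ?thesis
    unfolding resid_eq_sum[OF h] by (subst integral_eq_sum_mass[of _ n]) (auto intro: sum_mono le)
qed

text \<open>Pythagoras for the successive averages, with the variance over the children of a cell written
  as a sum over pairs.\<close>

lemma resid_diff_Suc:
  assumes h: "h \<in> L2 P"
  shows "resid h n - resid h (Suc n) =
    (\<Sum>u\<in>words A n. \<Sum>i\<in>A. \<Sum>j\<in>A. (N ^ Suc n * mass h (u @ [i]) - N ^ Suc n * mass h (u @ [j]))\<^sup>2)
      / (2 * N ^ (n + 2))"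
proof -
  have var: "(\<Sum>i\<in>A. \<Sum>j\<in>A. (b i - b j)\<^sup>2) = 2 * N * (\<Sum>i\<in>A. (b i)\<^sup>2) - 2 * (\<Sum>i\<in>A. b i)\<^sup>2" for b :: "'i \<Rightarrow> real"
  proof -
    have "(\<Sum>i\<in>A. \<Sum>j\<in>A. (b i - b j)\<^sup>2)
        = (\<Sum>i\<in>A. \<Sum>j\<in>A. (b i)\<^sup>2) + (\<Sum>i\<in>A. \<Sum>j\<in>A. (b j)\<^sup>2) - 2 * (\<Sum>i\<in>A. \<Sum>j\<in>A. b i * b j)"
      by (simp add: power2_diff sum.distrib sum_subtractf sum_distrib_left algebra_simps)
    also have "(\<Sum>i\<in>A. \<Sum>j\<in>A. b i * b j) = (\<Sum>i\<in>A. b i)\<^sup>2"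
      by (simp add: power2_eq_square sum_product)
    finally show ?thesis
      by (simp add: sum_distrib_left mult.assoc)
  qed
  have "(\<Sum>u\<in>words A n. \<Sum>i\<in>A. \<Sum>j\<in>A. (N ^ Suc n * mass h (u @ [i]) - N ^ Suc n * mass h (u @ [j]))\<^sup>2)
      = (\<Sum>u\<in>words A n. (N ^ Suc n)\<^sup>2 * (2 * N * (\<Sum>i\<in>A. (mass h (u @ [i]))\<^sup>2) - 2 * (mass h u)\<^sup>2))"
  proof (intro sum.cong refl)
    fix u assume u: "u \<in> words A n"
    have "(\<Sum>i\<in>A. \<Sum>j\<in>A. (N ^ Suc n * mass h (u @ [i]) - N ^ Suc n * mass h (u @ [j]))\<^sup>2)
       = (N ^ Suc n)\<^sup>2 * (\<Sum>i\<in>A. \<Sum>j\<in>A. (mass h (u @ [i]) - mass h (u @ [j]))\<^sup>2)"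
      unfolding sum_distrib_left by (simp only: right_diff_distrib[symmetric] power_mult_distrib)
    also have "\<dots> = (N ^ Suc n)\<^sup>2 * (2 * N * (\<Sum>i\<in>A. (mass h (u @ [i]))\<^sup>2) - 2 * (mass h u)\<^sup>2)"
      unfolding var mass_snoc[OF u L2_integrable[OF h]] ..
    finally show "(\<Sum>i\<in>A. \<Sum>j\<in>A. (N ^ Suc n * mass h (u @ [i]) - N ^ Suc n * mass h (u @ [j]))\<^sup>2) = \<dots>" .
  qed
  also have "\<dots> = (N ^ Suc n)\<^sup>2 * (2 * N * (\<Sum>w\<in>words A (Suc n). (mass h w)\<^sup>2) - 2 * (\<Sum>u\<in>words A n. (mass h u)\<^sup>2))"
    unfolding sum_words_Suc by (simp only: sum_distrib_left[symmetric] sum_subtractf)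
  \<comment> \<open>Division by \<open>2 * N ^ (n + 2)\<close> leaves \<open>N ^ Suc n\<close> times
    the sum of squares at level \<open>Suc n\<close> minus \<open>N ^ n\<close> times that at level
    \<open>n\<close>; the integral of the square of \<open>h\<close> cancels in the difference of
    residuals.\<close>
  finally show ?thesis
    unfolding resid_def using N_pos by (simp add: field_simps power2_eq_square)
qed

lemma resid_Suc_le: "h \<in> L2 P \<Longrightarrow> resid h (Suc n) \<le> resid h n"
proof -
  assume h: "h \<in> L2 P"
  have "0 \<le> resid h n - resid h (Suc n)"
    unfolding resid_diff_Suc[OF h] by (intro divide_nonneg_nonneg sum_nonneg) auto
  then show ?thesis by simp
qed

section \<open>Approximation by functions of finitely many letters\<close>

lemma L2_dist_triangle:
  assumes "f \<in> L2 P" "g \<in> L2 P" "h \<in> L2 P"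
  shows "(LINT x|P. (f x - h x)\<^sup>2) \<le> 2 * (LINT x|P. (f x - g x)\<^sup>2) + 2 * (LINT x|P. (g x - h x)\<^sup>2)"
proof -
  have int: "integrable P (\<lambda>x. (f x - h x)\<^sup>2)" "integrable P (\<lambda>x. (f x - g x)\<^sup>2)"
      "integrable P (\<lambda>x. (g x - h x)\<^sup>2)"
    using L2_diff assms by (auto simp: L2_def)
  have le: "(a - c)\<^sup>2 \<le> 2 * (a - b)\<^sup>2 + 2 * (b - c)\<^sup>2" for a b c :: real
    using sum_squares_bound[of "a - b" "b - c"] by (simp add: power2_eq_square algebra_simps)
  have "(LINT x|P. (f x - h x)\<^sup>2) \<le> (LINT x|P. 2 * (f x - g x)\<^sup>2 + 2 * (g x - h x)\<^sup>2)"
    using int by (intro integral_mono le) auto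
  also have "\<dots> = 2 * (LINT x|P. (f x - g x)\<^sup>2) + 2 * (LINT x|P. (g x - h x)\<^sup>2)"
    using int by simp
  finally show ?thesis .
qed

text \<open>Membership in the \<open>L2\<close> closure of the functions of finitely many letters.
  Measure-theoretic induction below shows that this closure is all of \<open>L2 P\<close>.\<close>

definition approximable :: "((nat \<Rightarrow> 'i) \<Rightarrow> real) \<Rightarrow> bool" where
  "approximable h \<longleftrightarrow> h \<in> L2 P \<and>
     (\<forall>\<epsilon>>0. \<exists>n c. (LINT \<omega>|P. (h \<omega> - c (map \<omega> [0..<n]))\<^sup>2) < \<epsilon>)"

lemma approximable_L2: "approximable h \<Longrightarrow> h \<in> L2 P"
  by (simp add: approximable_def)

lemma approximableE:
  assumes "approximable h" "\<epsilon> > 0"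
  obtains n c where "(LINT \<omega>|P. (h \<omega> - c (map \<omega> [0..<n]))\<^sup>2) < \<epsilon>"
  using assms by (auto simp: approximable_def)

lemma approximable_prefix_fun: "approximable (\<lambda>\<omega>. c (map \<omega> [0..<n]))"
  unfolding approximable_def
proof (intro conjI L2_prefix_fun allI impI exI)
  show "(LINT \<omega>|P. (c (map \<omega> [0..<n]) - c (map \<omega> [0..<n]))\<^sup>2) < \<epsilon>" if "\<epsilon> > 0" for \<epsilon> :: real
    using that by simp
qed

lemma approximable_closed:
  assumes h: "h \<in> L2 P"
    and approx: "\<And>\<epsilon>. \<epsilon> > 0 \<Longrightarrow> \<exists>g. approximable g \<and> (LINT \<omega>|P. (h \<omega> - g \<omega>)\<^sup>2) < \<epsilon>"
  shows "approximable h"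
  unfolding approximable_def
proof (intro conjI h allI impI)
  fix \<epsilon> :: real assume "\<epsilon> > 0"
  \<comment> \<open>The tolerance \<open>\<epsilon> / 4\<close> matches the two factors 2 in
    \<open>L2_dist_triangle\<close>.\<close>
  then obtain g where g: "approximable g" "(LINT \<omega>|P. (h \<omega> - g \<omega>)\<^sup>2) < \<epsilon> / 4"
    using approx[of "\<epsilon> / 4"] by auto
  from g(1) obtain n c where "(LINT \<omega>|P. (g \<omega> - c (map \<omega> [0..<n]))\<^sup>2) < \<epsilon> / 4"
    using \<open>\<epsilon> > 0\<close> by (auto elim: approximableE[of g "\<epsilon> / 4"])
  then have "(LINT \<omega>|P. (h \<omega> - c (map \<omega> [0..<n]))\<^sup>2) < \<epsilon>"
    using g(2) L2_dist_triangle[OF h approximable_L2[OF g(1)] L2_prefix_fun[of c n]] by linarith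
  then show "\<exists>n c. (LINT \<omega>|P. (h \<omega> - c (map \<omega> [0..<n]))\<^sup>2) < \<epsilon>"
    by blast
qed

text \<open>Dominated convergence: the squared errors tend to 0 pointwise and stay below four times
  the square of \<open>w\<close>. It supplies the limit steps for countable unions and for simple
  functions.\<close>

lemma approximable_lim:
  assumes F: "\<And>i::nat. approximable (F i)"
    and lim: "\<And>\<omega>. \<omega> \<in> space P \<Longrightarrow> (\<lambda>i. F i \<omega>) \<longlonglongrightarrow> h \<omega>"
    and dom: "\<And>i \<omega>. \<omega> \<in> space P \<Longrightarrow> \<bar>F i \<omega>\<bar> \<le> w \<omega>" and w: "w \<in> L2 P"
  shows "approximable h"
proof (rule approximable_closed)
  have Fm [measurable]: "F i \<in> borel_measurable P" for i
    using F by (auto simp: approximable_def L2_def)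
  have hm [measurable]: "h \<in> borel_measurable P"
    by (rule borel_measurable_LIMSEQ_metric[OF Fm lim])
  have w2: "integrable P (\<lambda>\<omega>. (w \<omega>)\<^sup>2)"
    using w by (simp add: L2_def)
  have hw: "\<bar>h \<omega>\<bar> \<le> w \<omega>" if "\<omega> \<in> space P" for \<omega>
    using LIMSEQ_le_const2[OF tendsto_rabs[OF lim[OF that]]] dom[OF that] by auto
  have "integrable P (\<lambda>\<omega>. (h \<omega>)\<^sup>2)"
  proof (rule Bochner_Integration.integrable_bound[OF w2])
    show "AE x in P. norm ((h x)\<^sup>2) \<le> norm ((w x)\<^sup>2)"
      using power_mono[OF hw, of _ 2] by (intro AE_I2) simp
  qed measurable
  then show h: "h \<in> L2 P" by (simp add: L2_def)
  have "(\<lambda>i. LINT \<omega>|P. (h \<omega> - F i \<omega>)\<^sup>2) \<longlonglongrightarrow> (LINT \<omega>|P. 0)"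
  proof (rule integral_dominated_convergence[where w = "\<lambda>\<omega>. 4 * (w \<omega>)\<^sup>2"])
    show "integrable P (\<lambda>\<omega>. 4 * (w \<omega>)\<^sup>2)" using w2 by simp
    show "AE \<omega> in P. (\<lambda>i. (h \<omega> - F i \<omega>)\<^sup>2) \<longlonglongrightarrow> 0"
    proof (intro AE_I2)
      fix \<omega> assume "\<omega> \<in> space P"
      then have "(\<lambda>i. (h \<omega> - F i \<omega>)\<^sup>2) \<longlonglongrightarrow> (h \<omega> - h \<omega>)\<^sup>2"
        by (intro tendsto_intros lim)
      then show "(\<lambda>i. (h \<omega> - F i \<omega>)\<^sup>2) \<longlonglongrightarrow> 0" by simp
    qed
    show "AE \<omega> in P. norm ((h \<omega> - F i \<omega>)\<^sup>2) \<le> 4 * (w \<omega>)\<^sup>2" for i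
    proof (intro AE_I2)
      fix \<omega> assume \<omega>: "\<omega> \<in> space P"
      have "\<bar>h \<omega> - F i \<omega>\<bar> \<le> 2 * w \<omega>"
        using hw[OF \<omega>] dom[OF \<omega>, of i] by linarith
      then have "\<bar>h \<omega> - F i \<omega>\<bar>\<^sup>2 \<le> (2 * w \<omega>)\<^sup>2"
        by (intro power_mono) auto
      then show "norm ((h \<omega> - F i \<omega>)\<^sup>2) \<le> 4 * (w \<omega>)\<^sup>2"
        by (simp add: power_mult_distrib)
    qed
  qed auto
  then have lim0: "(\<lambda>i. LINT \<omega>|P. (h \<omega> - F i \<omega>)\<^sup>2) \<longlonglongrightarrow> 0" by simp
  fix \<epsilon> :: real assume "\<epsilon> > 0"
  with lim0 have "\<forall>\<^sub>F i in sequentially. (LINT \<omega>|P. (h \<omega> - F i \<omega>)\<^sup>2) < \<epsilon>"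
    by (auto dest: order_tendstoD(2))
  then show "\<exists>g. approximable g \<and> (LINT \<omega>|P. (h \<omega> - g \<omega>)\<^sup>2) < \<epsilon>"
    using F by (auto simp: eventually_sequentially)
qed

lemma approximable_combine:
  assumes f: "approximable f" and g: "approximable g"
    and k: "(\<lambda>\<omega>. k (f \<omega>) (g \<omega>)) \<in> L2 P"
    and lip: "\<And>a b a' b'. (k a b - k a' b')\<^sup>2 \<le> B * ((a - a')\<^sup>2 + (b - b')\<^sup>2)" and B: "B > 0"
  shows "approximable (\<lambda>\<omega>. k (f \<omega>) (g \<omega>) :: real)"
  unfolding approximable_def
proof (intro conjI k allI impI)
  fix \<epsilon> :: real assume "\<epsilon> > 0"
  then have e: "\<epsilon> / (2 * B) > 0" using B by simp
  from f e obtain n c where c: "(LINT \<omega>|P. (f \<omega> - c (map \<omega> [0..<n]))\<^sup>2) < \<epsilon> / (2 * B)"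
    by (rule approximableE)
  from g e obtain m d where d: "(LINT \<omega>|P. (g \<omega> - d (map \<omega> [0..<m]))\<^sup>2) < \<epsilon> / (2 * B)"
    by (rule approximableE)
  \<comment> \<open>The two approximants may look at prefixes of different lengths; both are read
    off the common prefix of length \<open>max n m\<close>.\<close>
  define e where "e u = k (c (take n u)) (d (take m u))" for u
  define l where "l = max n m"
  have e_eq: "e (map \<omega> [0..<l]) = k (c (map \<omega> [0..<n])) (d (map \<omega> [0..<m]))" for \<omega>
    by (simp add: e_def l_def take_prefix)
  have int: "integrable P (\<lambda>\<omega>. (f \<omega> - c (map \<omega> [0..<n]))\<^sup>2)" "integrable P (\<lambda>\<omega>. (g \<omega> - d (map \<omega> [0..<m]))\<^sup>2)"
      "integrable P (\<lambda>\<omega>. (k (f \<omega>) (g \<omega>) - e (map \<omega> [0..<l]))\<^sup>2)"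
    using L2_diff[OF approximable_L2[OF f] L2_prefix_fun] L2_diff[OF approximable_L2[OF g] L2_prefix_fun]
      L2_diff[OF k L2_prefix_fun[of e l]]
    by (auto simp: L2_def)
  have "(LINT \<omega>|P. (k (f \<omega>) (g \<omega>) - e (map \<omega> [0..<l]))\<^sup>2)
      \<le> (LINT \<omega>|P. B * ((f \<omega> - c (map \<omega> [0..<n]))\<^sup>2 + (g \<omega> - d (map \<omega> [0..<m]))\<^sup>2))"
    using int lip by (intro integral_mono) (auto simp: e_eq)
  also have "\<dots> = B * ((LINT \<omega>|P. (f \<omega> - c (map \<omega> [0..<n]))\<^sup>2) + (LINT \<omega>|P. (g \<omega> - d (map \<omega> [0..<m]))\<^sup>2))"
    using int by simp
  also have "\<dots> < B * (\<epsilon> / (2 * B) + \<epsilon> / (2 * B))"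
    using c d B by (intro mult_strict_left_mono) auto
  also have "\<dots> = \<epsilon>" using B by simp
  finally show "\<exists>n c. (LINT \<omega>|P. (k (f \<omega>) (g \<omega>) - c (map \<omega> [0..<n]))\<^sup>2) < \<epsilon>"
    by blast
qed

lemma approximable_add:
  assumes "approximable f" "approximable g"
  shows "approximable (\<lambda>\<omega>. f \<omega> + g \<omega>)"
proof (rule approximable_combine[OF assms, where k = "(+)" and B = 2])
  show "(\<lambda>\<omega>. f \<omega> + g \<omega>) \<in> L2 P"
    using assms by (intro L2_add approximable_L2)
  show "(a + b - (a' + b'))\<^sup>2 \<le> 2 * ((a - a')\<^sup>2 + (b - b')\<^sup>2)" for a b a' b' :: real
    using sum_squares_bound[of "a - a'" "b - b'"] by (simp add: power2_eq_square algebra_simps)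
qed simp

lemma approximable_cmult:
  assumes "approximable f"
  shows "approximable (\<lambda>\<omega>. c * f \<omega>)"
proof (rule approximable_combine[OF assms assms, where k = "\<lambda>a _. c * a" and B = "c\<^sup>2 + 1"])
  show "(\<lambda>\<omega>. c * f \<omega>) \<in> L2 P"
    using assms by (intro L2_cmult approximable_L2)
  show "(c * a - c * a')\<^sup>2 \<le> (c\<^sup>2 + 1) * ((a - a')\<^sup>2 + (b - b')\<^sup>2)" for a b a' b' :: real
  proof -
    have "(c * a - c * a')\<^sup>2 = c\<^sup>2 * (a - a')\<^sup>2"
      by (simp add: power_mult_distrib flip: right_diff_distrib)
    also have "\<dots> \<le> (c\<^sup>2 + 1) * ((a - a')\<^sup>2 + (b - b')\<^sup>2)"
      by (intro mult_mono) auto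
    finally show ?thesis .
  qed
qed (simp add: add_nonneg_pos)

text \<open>The indicator of a union is a maximum, and \<open>max\<close> is a Lipschitz function of
  its two arguments; this handles the finite unions in the induction over the sigma-algebra.\<close>

lemma approximable_max_indicator:
  assumes "approximable (indicator X)" "approximable (indicator Y)"
  shows "approximable (indicator (X \<union> Y))"
proof -
  have max: "(max a b - max a' b')\<^sup>2 \<le> 1 * ((a - a')\<^sup>2 + (b - b')\<^sup>2)" for a b a' b' :: real
  proof -
    have "\<bar>max a b - max a' b'\<bar> \<le> max \<bar>a - a'\<bar> \<bar>b - b'\<bar>"
      by linarith
    then have "\<bar>max a b - max a' b'\<bar>\<^sup>2 \<le> (max \<bar>a - a'\<bar> \<bar>b - b'\<bar>)\<^sup>2"
      by (intro power_mono) auto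
    also have "\<dots> \<le> (a - a')\<^sup>2 + (b - b')\<^sup>2"
      by (auto simp: max_def)
    finally show ?thesis by simp
  qed
  have eq: "indicator (X \<union> Y) = (\<lambda>\<omega>. max (indicator X \<omega>) (indicator Y \<omega>) :: real)"
    by (auto simp: indicator_def)
  have "(\<lambda>\<omega>. max (indicator X \<omega>) (indicator Y \<omega>) :: real) \<in> L2 P"
  proof (rule L2_bounded[of _ 1])
    show "(\<lambda>\<omega>. max (indicator X \<omega>) (indicator Y \<omega>) :: real) \<in> borel_measurable P"
      using assms[THEN approximable_L2, THEN L2_measurable] by (intro borel_measurable_max)
  qed (auto simp: indicator_def)
  from approximable_combine[OF assms this max] show ?thesis
    unfolding eq by simp
qed

text \<open>The constant sequence in \<open>approximable_lim\<close> also delivers the measurability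
  of \<open>g\<close>.\<close>

lemma approximable_cong:
  assumes "approximable f" "\<And>\<omega>. \<omega> \<in> space P \<Longrightarrow> f \<omega> = g \<omega>"
  shows "approximable g"
  using approximable_lim[of "\<lambda>_. f" g "\<lambda>\<omega>. \<bar>f \<omega>\<bar>"] assms approximable_L2[OF assms(1)]
  by (auto simp: L2_def)

text \<open>Induction over the sigma-algebra generated by conditions on a single letter. Complements
  are affine images, and countable unions are limits of finite ones.\<close>

lemma approximable_indicator:
  assumes "X \<in> sets P"
  shows "approximable (indicator X)"
  using assms unfolding sets_PiM_single
proof (induction rule: sigma_sets.induct)
  case (Basic X)
  then obtain i B where X: "X = {f \<in> \<Pi>\<^sub>E i\<in>UNIV. space (uniform_count_measure A). f i \<in> B}"
    by auto
  \<comment> \<open>Letters are numbered from 0, so letter \<open>i\<close> is visible in the prefix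
    of length \<open>Suc i\<close>.\<close>
  have "approximable (\<lambda>\<omega>. indicator B (map \<omega> [0..<Suc i] ! i))"
    by (rule approximable_prefix_fun)
  then show ?case
    by (rule approximable_cong) (auto simp: X space_PiM nth_append indicator_def)
next
  case Empty
  then show ?case
    using approximable_prefix_fun[of "\<lambda>_. 0" 0] by (simp add: indicator_def[abs_def])
next
  case (Compl X)
  have "approximable (\<lambda>\<omega>. 1 + (-1) * indicator X \<omega>)"
    by (intro approximable_add approximable_cmult Compl.IH approximable_prefix_fun[of "\<lambda>_. 1"])
  then show ?case
    by (rule approximable_cong) (auto simp: space_PiM indicator_def)
next
  case (Union X)
  have fin: "approximable (indicator (\<Union>i<n. X i))" for n :: nat
  proof (induction n)
    case 0
    then show ?case
      using approximable_prefix_fun[of "\<lambda>_. 0" 0] by (simp add: indicator_def[abs_def])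
  next
    case (Suc n)
    from approximable_max_indicator[OF Union.IH[of n] this] show ?case
      by (simp add: lessThan_Suc)
  qed
  show ?case
  proof (rule approximable_lim[OF fin])
    show "(\<lambda>n. indicator (\<Union>i<n. X i) \<omega>) \<longlonglongrightarrow> indicat_real (\<Union>i. X i) \<omega>" for \<omega>
      by (rule LIMSEQ_indicator_UN)
    show "(\<lambda>_. 1) \<in> L2 P"
      by (rule L2_bounded[of _ 1]) auto
  qed (auto simp: indicator_def)
qed

lemma approximable_sum:
  assumes "finite T" "\<And>y. y \<in> T \<Longrightarrow> approximable (f y)"
  shows "approximable (\<lambda>\<omega>. \<Sum>y\<in>T. f y \<omega>)"
  using assms
proof (induction T rule: finite_induct)
  case empty
  then show ?case using approximable_prefix_fun[of "\<lambda>_. 0" 0] by simp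
next
  case (insert y T)
  then show ?case by (simp add: approximable_add)
qed

text \<open>Simple functions converging to \<open>h\<close> can be chosen below
  \<open>2 * \<bar>h\<bar>\<close>, which is square integrable and serves as the dominating
  function.\<close>

lemma L2_approximable:
  assumes h: "h \<in> L2 P"
  shows "approximable h"
proof -
  have hm: "h \<in> borel_measurable P" using h by (simp add: L2_def)
  obtain F where F: "\<And>i. simple_function P (F i)" "\<And>x. x \<in> space P \<Longrightarrow> (\<lambda>i. F i x) \<longlonglongrightarrow> h x"
      "\<And>i x. x \<in> space P \<Longrightarrow> dist (F i x) 0 \<le> 2 * dist (h x) 0"
    using borel_measurable_implies_sequence_metric[OF hm, of 0] by blast
  show ?thesis
  proof (rule approximable_lim)
    fix i
    have "approximable (\<lambda>\<omega>. \<Sum>y\<in>F i ` space P. y * indicator (F i -` {y} \<inter> space P) \<omega>)"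
      using F(1)[of i]
      by (intro approximable_sum approximable_cmult approximable_indicator) (auto simp: simple_function_def)
    then show "approximable (F i)"
    proof (rule approximable_cong)
      fix \<omega> assume "\<omega> \<in> space P"
      then show "(\<Sum>y\<in>F i ` space P. y * indicator (F i -` {y} \<inter> space P) \<omega>) = F i \<omega>"
        by (intro trans[OF sum.cong simple_function_indicator_representation_banach[OF F(1), symmetric]]) auto
    qed
  next
    show "\<bar>F i x\<bar> \<le> 2 * \<bar>h x\<bar>" if "x \<in> space P" for i x
      using F(3)[OF that] by simp
    show "(\<lambda>x. 2 * \<bar>h x\<bar>) \<in> L2 P"
      using h by (intro L2_cmult) (auto simp: L2_def)
  qed (rule F(2))
qed

text \<open>A good approximation at one level bounds the residual there by \<open>resid_le\<close>;
  at later levels the residual can only decrease.\<close>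

lemma resid_tendsto_0:
  assumes h: "h \<in> L2 P"
  shows "resid h \<longlonglongrightarrow> 0"
proof (rule LIMSEQ_I)
  fix \<epsilon> :: real assume "\<epsilon> > 0"
  with L2_approximable[OF h] obtain n c where "(LINT \<omega>|P. (h \<omega> - c (map \<omega> [0..<n]))\<^sup>2) < \<epsilon>"
    by (rule approximableE)
  then have n: "resid h n < \<epsilon>"
    using resid_le[OF h, of n c] by linarith
  have "decseq (resid h)"
    by (intro decseq_SucI resid_Suc_le h)
  then have "norm (resid h m - 0) < \<epsilon>" if "m \<ge> n" for m
    using n that resid_nonneg[OF h, of m] by (auto dest: decseqD[of _ n m])
  then show "\<exists>n. \<forall>m\<ge>n. norm (resid h m - 0) < \<epsilon>" by blast
qed

end

section \<open>Discrete and continuous energies\<close>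

text \<open>Induction along the chain: each further link turns the constant \<open>c\<close> into
  \<open>2 * c + 2\<close>, because the square of a sum of two terms is at most twice the sum of
  their squares. The constant depends on the chain but not on \<open>g\<close>.\<close>

lemma rtrancl_square_diff_le:
  fixes E :: "('i \<times> 'i) set"
  assumes "(i, j) \<in> E\<^sup>*" "finite E"
  shows "\<exists>c\<ge>0. \<forall>g :: 'i \<Rightarrow> real. (g i - g j)\<^sup>2 \<le> c * (\<Sum>(k, l)\<in>E. (g k - g l)\<^sup>2)"
  using assms(1)
proof (induction rule: rtrancl_induct)
  case base
  show ?case by (intro exI[of _ 0]) simp
next
  case (step j k)
  then obtain c where c: "c \<ge> 0"
      "\<And>g :: 'i \<Rightarrow> real. (g i - g j)\<^sup>2 \<le> c * (\<Sum>(k, l)\<in>E. (g k - g l)\<^sup>2)"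
    by blast
  have "(g i - g k)\<^sup>2 \<le> (2 * c + 2) * (\<Sum>(k, l)\<in>E. (g k - g l)\<^sup>2)" for g :: "'i \<Rightarrow> real"
  proof -
    have "(g j - g k)\<^sup>2 \<le> (\<Sum>(k, l)\<in>E. (g k - g l)\<^sup>2)"
      using member_le_sum[OF step.hyps(2), of "\<lambda>(k, l). (g k - g l)\<^sup>2"] assms(2) by auto
    moreover have "(g i - g k)\<^sup>2 \<le> 2 * (g i - g j)\<^sup>2 + 2 * (g j - g k)\<^sup>2"
      using sum_squares_bound[of "g i - g j" "g j - g k"] by (simp add: power2_eq_square algebra_simps)
    ultimately show ?thesis
      using c(2)[of g] by (simp add: algebra_simps)
  qed
  then show ?case
    using c(1) by (intro exI[of _ "2 * c + 2"]) simp
qed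

text \<open>A Poincare inequality for a finite connected graph with edge set \<open>E\<close>,
  obtained by adding the chain estimates over all pairs of vertices.\<close>

lemma connected_square_diff_sum_le:
  fixes E :: "('i \<times> 'i) set"
  assumes "finite A" "finite E" "\<And>i j. i \<in> A \<Longrightarrow> j \<in> A \<Longrightarrow> (i, j) \<in> E\<^sup>*"
  shows "\<exists>c\<ge>0. \<forall>g :: 'i \<Rightarrow> real. (\<Sum>i\<in>A. \<Sum>j\<in>A. (g i - g j)\<^sup>2) \<le> c * (\<Sum>(k, l)\<in>E. (g k - g l)\<^sup>2)"
proof -
  have "\<exists>c. \<forall>i\<in>A. \<forall>j\<in>A. c i j \<ge> 0 \<and>
      (\<forall>g :: 'i \<Rightarrow> real. (g i - g j)\<^sup>2 \<le> c i j * (\<Sum>(k, l)\<in>E. (g k - g l)\<^sup>2))"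
    using rtrancl_square_diff_le[OF assms(3,2)] by (intro bchoice ballI) meson
  then obtain c where c: "\<And>i j. i \<in> A \<Longrightarrow> j \<in> A \<Longrightarrow> c i j \<ge> 0"
      "\<And>i j g. i \<in> A \<Longrightarrow> j \<in> A \<Longrightarrow> (g i - g j)\<^sup>2 \<le> c i j * (\<Sum>(k, l)\<in>E. ((g k :: real) - g l)\<^sup>2)"
    by blast
  have "(\<Sum>i\<in>A. \<Sum>j\<in>A. (g i - g j)\<^sup>2) \<le> (\<Sum>i\<in>A. \<Sum>j\<in>A. c i j) * (\<Sum>(k, l)\<in>E. (g k - g l)\<^sup>2)"
    for g :: "'i \<Rightarrow> real"
    unfolding sum_distrib_right by (intro sum_mono c(2))
  then show ?thesis
    by (intro exI[of _ "\<Sum>i\<in>A. \<Sum>j\<in>A. c i j"]) (auto intro!: sum_nonneg c(1))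
qed

section \<open>Energies over pairs of sequences with related prefixes\<close>

context bernoulli
begin

lemma pair_integral_mult:
  fixes f g :: "(nat \<Rightarrow> 'i) \<Rightarrow> real"
  assumes f: "integrable P f" and g: "integrable P g"
  shows "integrable (P \<Otimes>\<^sub>M P) (\<lambda>z. f (fst z) * g (snd z))"
    and "(LINT z|(P \<Otimes>\<^sub>M P). f (fst z) * g (snd z)) = (LINT x|P. f x) * (LINT y|P. g y)"
proof -
  have [measurable]: "f \<in> borel_measurable P" "g \<in> borel_measurable P"
    using f g by auto
  show int: "integrable (P \<Otimes>\<^sub>M P) (\<lambda>z. f (fst z) * g (snd z))"
    by (rule PP.Fubini_integrable) (use f g in \<open>auto simp: abs_mult\<close>)
  show "(LINT z|(P \<Otimes>\<^sub>M P). f (fst z) * g (snd z)) = (LINT x|P. f x) * (LINT y|P. g y)"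
    using PP.integral_fst'[OF int] by simp
qed

lemma pair_L2_integrable:
  assumes h: "h \<in> L2 P"
  shows "integrable (P \<Otimes>\<^sub>M P) (\<lambda>z. (h (fst z) - h (snd z))\<^sup>2)"
proof -
  have sq: "integrable P (\<lambda>x. (h x)\<^sup>2)" using h by (simp add: L2_def)
  have "integrable (P \<Otimes>\<^sub>M P) (\<lambda>z. ((h (fst z))\<^sup>2 * 1 + 1 * (h (snd z))\<^sup>2) - 2 * (h (fst z) * h (snd z)))"
    by (intro Bochner_Integration.integrable_add Bochner_Integration.integrable_diff integrable_mult_right
        pair_integral_mult(1) sq L2_integrable[OF h] pair_integral_mult(1)[of "\<lambda>_. 1" "\<lambda>x. (h x)\<^sup>2"]
        pair_integral_mult(1)[of "\<lambda>x. (h x)\<^sup>2" "\<lambda>_. 1"]) auto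
  then show ?thesis
    by (simp add: power2_diff mult.assoc)
qed

text \<open>This is the quantity \<open>J n\<close> of the introduction, with the link relation
  replaced by an arbitrary set \<open>R\<close> of pairs of words.\<close>

definition pair_energy :: "('i list \<times> 'i list) set \<Rightarrow> nat \<Rightarrow> ((nat \<Rightarrow> 'i) \<Rightarrow> real) \<Rightarrow> real" where
  "pair_energy R n h = (LINT z|(P \<Otimes>\<^sub>M P).
     indicator {(x, y). (map x [0..<n], map y [0..<n]) \<in> R} z * (h (fst z) - h (snd z))\<^sup>2)"

definition avg_energy :: "('i list \<times> 'i list) set \<Rightarrow> nat \<Rightarrow> ((nat \<Rightarrow> 'i) \<Rightarrow> real) \<Rightarrow> real" where
  "avg_energy R n h = (\<Sum>(v, w)\<in>R. (N ^ n * mass h v - N ^ n * mass h w)\<^sup>2)"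

lemma avg_energy_nonneg: "0 \<le> avg_energy R n h"
  unfolding avg_energy_def by (intro sum_nonneg) auto

lemma pair_energy_nonneg: "0 \<le> pair_energy R n h"
  unfolding pair_energy_def by (intro integral_nonneg_AE AE_I2) auto

text \<open>On a product of two cylinders the expanded square is a sum of products of functions of
  one variable each, so its integral is a polynomial in masses. Completing the square separates the
  difference of the means from the two variances.\<close>

lemma pair_energy_eq:
  assumes h: "h \<in> L2 P" and R: "R \<subseteq> words A n \<times> words A n"
  shows "pair_energy R n h = avg_energy R n h / (N ^ n)\<^sup>2 + (\<Sum>(v, w)\<in>R.
      (mass (\<lambda>x. (h x)\<^sup>2) v - N ^ n * (mass h v)\<^sup>2) + (mass (\<lambda>x. (h x)\<^sup>2) w - N ^ n * (mass h w)\<^sup>2)) / N ^ n"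
proof -
  have sq: "integrable P (\<lambda>x. (h x)\<^sup>2)" using h by (simp add: L2_def)
  have finR: "finite R"
    using finite_subset[OF R] finite_A by simp
  \<comment> \<open>The expanded integrand, cut off to the product of the cylinders of
    \<open>v\<close> and \<open>w\<close>; each term is a function of the first sequence times one
    of the second.\<close>
  define H where "H v w z = (indicator (cyl A v) (fst z) * (h (fst z))\<^sup>2) * indicator (cyl A w) (snd z)
      + indicator (cyl A v) (fst z) * (indicator (cyl A w) (snd z) * (h (snd z))\<^sup>2)
      - 2 * ((indicator (cyl A v) (fst z) * h (fst z)) * (indicator (cyl A w) (snd z) * h (snd z)))" for v w z
  have int: "integrable (P \<Otimes>\<^sub>M P) (H v w)"
    and eq: "(LINT z|(P \<Otimes>\<^sub>M P). H v w z) = (mass (\<lambda>x. (h x)\<^sup>2) v + mass (\<lambda>x. (h x)\<^sup>2) w) / N ^ n - 2 * mass h v * mass h w"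
    if v: "v \<in> words A n" and w: "w \<in> words A n" for v w
  proof -
    have 1: "integrable P (\<lambda>x. indicator (cyl A u) x :: real)" "(LINT x|P. indicator (cyl A u) x :: real) = 1 / N ^ n"
      if "u \<in> words A n" for u
      using integrable_cyl[OF that, of "\<lambda>_. 1"] mass_const[OF that, of 1] by (auto simp: mass_def)
    note i = pair_integral_mult[OF integrable_cyl[OF v sq] 1(1)[OF w]]
      pair_integral_mult[OF 1(1)[OF v] integrable_cyl[OF w sq]]
      pair_integral_mult[OF integrable_cyl[OF v L2_integrable[OF h]] integrable_cyl[OF w L2_integrable[OF h]]]
    show "integrable (P \<Otimes>\<^sub>M P) (H v w)"
      unfolding H_def[abs_def]
      by (intro Bochner_Integration.integrable_add Bochner_Integration.integrable_diff integrable_mult_right i)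
    show "(LINT z|(P \<Otimes>\<^sub>M P). H v w z) = (mass (\<lambda>x. (h x)\<^sup>2) v + mass (\<lambda>x. (h x)\<^sup>2) w) / N ^ n - 2 * mass h v * mass h w"
      unfolding H_def
      by (simp add: i measure_cyl[OF v] measure_cyl[OF w] mass_def add_divide_distrib sets.Int_space_eq2[OF sets_cyl[OF v]]
          sets.Int_space_eq2[OF sets_cyl[OF w]])
  qed
  have "pair_energy R n h = (LINT z|(P \<Otimes>\<^sub>M P). (\<Sum>(v, w)\<in>R. H v w z))"
    unfolding pair_energy_def
  proof (intro Bochner_Integration.integral_cong refl)
    fix z assume "z \<in> space (P \<Otimes>\<^sub>M P)"
    then obtain x y where z: "z = (x, y)" and x: "range x \<subseteq> A" and y: "range y \<subseteq> A"
      by (auto simp: space_pair_measure space_P)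
    \<comment> \<open>At a given pair of sequences only the term indexed by their own prefixes can
      survive.\<close>
    have "(\<Sum>(v, w)\<in>R. H v w z) = (\<Sum>p\<in>R. if p = (map x [0..<n], map y [0..<n]) then (h x - h y)\<^sup>2 else 0)"
    proof (intro sum.cong refl)
      fix p assume "p \<in> R"
      then obtain v w where p: "p = (v, w)" "v \<in> words A n" "w \<in> words A n" using R by auto
      then show "(case p of (v, w) \<Rightarrow> H v w z) = (if p = (map x [0..<n], map y [0..<n]) then (h x - h y)\<^sup>2 else 0)"
        by (simp add: H_def z indicator_cyl[OF x] indicator_cyl[OF y] power2_diff)
    qed
    also have "\<dots> = indicator {(x, y). (map x [0..<n], map y [0..<n]) \<in> R} z * (h (fst z) - h (snd z))\<^sup>2"
      using finR by (simp add: z)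
    finally show "indicator {(x, y). (map x [0..<n], map y [0..<n]) \<in> R} z * (h (fst z) - h (snd z))\<^sup>2
        = (\<Sum>(v, w)\<in>R. H v w z)" ..
  qed
  also have "\<dots> = (\<Sum>(v, w)\<in>R. (mass (\<lambda>x. (h x)\<^sup>2) v + mass (\<lambda>x. (h x)\<^sup>2) w) / N ^ n - 2 * mass h v * mass h w)"
    using int eq R unfolding case_prod_unfold
    by (subst Bochner_Integration.integral_sum) (auto intro!: sum.cong)
  also have "\<dots> = (\<Sum>(v, w)\<in>R. (N ^ n * mass h v - N ^ n * mass h w)\<^sup>2 / (N ^ n)\<^sup>2 +
      ((mass (\<lambda>x. (h x)\<^sup>2) v - N ^ n * (mass h v)\<^sup>2) + (mass (\<lambda>x. (h x)\<^sup>2) w - N ^ n * (mass h w)\<^sup>2)) / N ^ n)"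
  proof -
    have "(x + y) / M - 2 * a * b = (M * a - M * b)\<^sup>2 / M\<^sup>2 + ((x - M * a\<^sup>2) + (y - M * b\<^sup>2)) / M"
      if "M > 0" for x y a b M :: real
      using that by (simp add: field_simps power2_eq_square)
    then show ?thesis
      using N_pos by (intro sum.cong refl) (simp add: case_prod_unfold)
  qed
  also have "\<dots> = avg_energy R n h / (N ^ n)\<^sup>2 + (\<Sum>(v, w)\<in>R.
      (mass (\<lambda>x. (h x)\<^sup>2) v - N ^ n * (mass h v)\<^sup>2) + (mass (\<lambda>x. (h x)\<^sup>2) w - N ^ n * (mass h w)\<^sup>2)) / N ^ n"
    unfolding avg_energy_def case_prod_unfold sum_divide_distrib by (rule sum.distrib)
  finally show ?thesis .
qed

text \<open>The variance terms in \<open>pair_energy_eq\<close> are nonnegative and are dropped,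
  which gives the estimate with constant 1.\<close>

lemma avg_energy_le_pair_energy:
  assumes h: "h \<in> L2 P" and R: "R \<subseteq> words A n \<times> words A n"
  shows "avg_energy R n h / N ^ n \<le> N ^ n * pair_energy R n h"
proof -
  have "0 \<le> (\<Sum>(v, w)\<in>R. (mass (\<lambda>x. (h x)\<^sup>2) v - N ^ n * (mass h v)\<^sup>2) +
      (mass (\<lambda>x. (h x)\<^sup>2) w - N ^ n * (mass h w)\<^sup>2)) / N ^ n"
    using R by (intro divide_nonneg_nonneg sum_nonneg) (auto intro!: add_nonneg_nonneg mass_variance_nonneg h)
  then have "avg_energy R n h / (N ^ n)\<^sup>2 \<le> pair_energy R n h"
    unfolding pair_energy_eq[OF assms] by simp
  then have "N ^ n * (avg_energy R n h / (N ^ n)\<^sup>2) \<le> N ^ n * pair_energy R n h"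
    using N_pos by (intro mult_left_mono) auto
  then show ?thesis
    using N_pos by (simp add: power2_eq_square)
qed

text \<open>By symmetry of \<open>R\<close> the variances of the first and of the second words have
  the same sum over \<open>R\<close>. Grouped by the second word, each variance occurs at most
  \<open>C\<close> times, and their total is the residual.\<close>

lemma pair_energy_le:
  assumes h: "h \<in> L2 P" and R: "R \<subseteq> words A n \<times> words A n" "sym R"
    and C: "\<And>w. w \<in> words A n \<Longrightarrow> card {v. (v, w) \<in> R} \<le> C"
  shows "N ^ n * pair_energy R n h \<le> avg_energy R n h / N ^ n + 2 * real C * resid h n"
proof -
  define V where "V w = mass (\<lambda>x. (h x)\<^sup>2) w - N ^ n * (mass h w)\<^sup>2" for w
  have V: "V w \<ge> 0" if "w \<in> words A n" for w
    unfolding V_def by (rule mass_variance_nonneg[OF h that])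
  have finR: "finite R"
    using finite_subset[OF R(1)] finite_A by simp
  have swap: "(\<Sum>(v, w)\<in>R. V v) = (\<Sum>(v, w)\<in>R. V w)"
    by (rule sum.reindex_bij_witness[where i = prod.swap and j = prod.swap])
      (use R(2) in \<open>auto simp: sym_def\<close>)
  have "(\<Sum>(v, w)\<in>R. V w) \<le> real C * resid h n"
  proof -
    have "(\<Sum>(v, w)\<in>R. V w) = (\<Sum>w\<in>words A n. \<Sum>v\<in>{v. (v, w) \<in> R}. V w)"
    proof -
      have "(\<Sum>w\<in>words A n. \<Sum>v\<in>{v. (v, w) \<in> R}. V w) = (\<Sum>(w, v)\<in>Sigma (words A n) (\<lambda>w. {v. (v, w) \<in> R}). V w)"
      proof (intro sum.Sigma ballI)
        show "finite {v. (v, w) \<in> R}" for w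
          by (rule finite_subset[OF _ finite_imageI[OF finR, of fst]]) force
      qed (use finite_A in simp)
      also have "\<dots> = (\<Sum>(v, w)\<in>R. V w)"
        by (rule sum.reindex_bij_witness[where i = prod.swap and j = prod.swap]) (use R(1) in auto)
      finally show ?thesis ..
    qed
    also have "\<dots> \<le> (\<Sum>w\<in>words A n. real C * V w)"
      using C V by (intro sum_mono) (auto intro!: mult_right_mono)
    also have "\<dots> = real C * resid h n"
      unfolding resid_eq_sum[OF h] V_def sum_distrib_left ..
    finally show ?thesis .
  qed
  moreover have "N ^ n * pair_energy R n h = avg_energy R n h / N ^ n + 2 * (\<Sum>(v, w)\<in>R. V w)"
  proof -
    have "(\<Sum>(v, w)\<in>R. V v + V w) = 2 * (\<Sum>(v, w)\<in>R. V w)"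
      using swap by (simp add: case_prod_unfold sum.distrib)
    then show ?thesis
      unfolding pair_energy_eq[OF h R(1)] V_def using N_pos by (simp add: field_simps power2_eq_square)
  qed
  ultimately show ?thesis by simp
qed

text \<open>The Poincare inequality of the graph \<open>E\<close> is applied to the children of
  every word \<open>u\<close>. Its constant depends on \<open>A\<close> and \<open>E\<close> alone,
  so \<open>c\<close> is uniform in \<open>h\<close>, \<open>n\<close> and \<open>R\<close>.\<close>

lemma resid_recursion:
  assumes E: "E \<subseteq> A \<times> A" "\<And>i j. i \<in> A \<Longrightarrow> j \<in> A \<Longrightarrow> (i, j) \<in> E\<^sup>*"
  shows "\<exists>c\<ge>0. \<forall>h n R. h \<in> L2 P \<longrightarrow> R \<subseteq> words A (Suc n) \<times> words A (Suc n) \<longrightarrow>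
     (\<forall>u\<in>words A n. \<forall>(i, j)\<in>E. (u @ [i], u @ [j]) \<in> R) \<longrightarrow>
     resid h n \<le> resid h (Suc n) + c * (avg_energy R (Suc n) h / N ^ Suc n)"
proof -
  have finE: "finite E"
    using finite_subset[OF E(1)] finite_A by simp
  obtain c where c: "c \<ge> 0"
      "\<And>g :: 'i \<Rightarrow> real. (\<Sum>i\<in>A. \<Sum>j\<in>A. (g i - g j)\<^sup>2) \<le> c * (\<Sum>(k, l)\<in>E. (g k - g l)\<^sup>2)"
    using connected_square_diff_sum_le[OF finite_A finE E(2)] by blast
  show ?thesis
  proof (intro exI[of _ c] conjI c(1) allI impI)
    fix h n R
    assume h: "h \<in> L2 P" and R: "R \<subseteq> words A (Suc n) \<times> words A (Suc n)"
      and sub: "\<forall>u\<in>words A n. \<forall>(i, j)\<in>E. (u @ [i], u @ [j]) \<in> R"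
    define g where "g w = N ^ Suc n * mass h w" for w
    have "(\<Sum>u\<in>words A n. \<Sum>i\<in>A. \<Sum>j\<in>A. (g (u @ [i]) - g (u @ [j]))\<^sup>2)
        \<le> (\<Sum>u\<in>words A n. c * (\<Sum>(k, l)\<in>E. (g (u @ [k]) - g (u @ [l]))\<^sup>2))"
      by (intro sum_mono c(2))
    also have "\<dots> = c * (\<Sum>(u, k, l)\<in>words A n \<times> E. (g (u @ [k]) - g (u @ [l]))\<^sup>2)"
      by (simp add: sum_distrib_left sum.cartesian_product case_prod_unfold)
    \<comment> \<open>A pair of children determines \<open>u\<close> and both letters, so no link is
      counted twice and the sum can be enlarged to all of \<open>R\<close>.\<close>
    also have "(\<Sum>(u, k, l)\<in>words A n \<times> E. (g (u @ [k]) - g (u @ [l]))\<^sup>2)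
        = (\<Sum>(v, w)\<in>(\<lambda>(u, k, l). (u @ [k], u @ [l])) ` (words A n \<times> E). (g v - g w)\<^sup>2)"
      by (subst sum.reindex) (auto simp: inj_on_def case_prod_unfold)
    also have "c * \<dots> \<le> c * (\<Sum>(v, w)\<in>R. (g v - g w)\<^sup>2)"
      using sub finite_subset[OF R] finite_A by (intro mult_left_mono sum_mono2 c(1)) auto
    finally have "(\<Sum>u\<in>words A n. \<Sum>i\<in>A. \<Sum>j\<in>A. (g (u @ [i]) - g (u @ [j]))\<^sup>2) \<le> c * avg_energy R (Suc n) h"
      by (simp add: avg_energy_def g_def)
    then have "resid h n - resid h (Suc n) \<le> c * avg_energy R (Suc n) h / (2 * N ^ (n + 2))"
      unfolding resid_diff_Suc[OF h] g_def using N_pos by (intro divide_right_mono) auto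
    also have "\<dots> \<le> c * avg_energy R (Suc n) h / N ^ Suc n"
    proof (rule divide_left_mono)
      have "N ^ Suc n \<le> N ^ (n + 2)"
        using N_ge_1 by (intro power_increasing) auto
      then show "N ^ Suc n \<le> 2 * N ^ (n + 2)"
        using zero_le_power[of N "n + 2"] N_pos by linarith
    qed (use c(1) avg_energy_nonneg[of R "Suc n" h] N_pos in auto)
    finally show "resid h n \<le> resid h (Suc n) + c * (avg_energy R (Suc n) h / N ^ Suc n)"
      by simp
  qed
qed

text \<open>Weighted by \<open>s ^ n\<close>, the square roots of the residuals obey a backward
  recursion with ratio \<open>1 / s\<close>, driven by the averaged energies. The Hardy inequality
  solves it, and \<open>pair_energy_le\<close> passes from residuals to pair energies.\<close>

lemma lq_norm_pair_energy_le:
  assumes q: "1 \<le> q" and s: "s > 1"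
    and R: "\<And>n. R n \<subseteq> words A n \<times> words A n" "\<And>n. sym (R n)"
    and C: "\<And>n w. w \<in> words A n \<Longrightarrow> card {v. (v, w) \<in> R n} \<le> C"
    and E: "E \<subseteq> A \<times> A" "\<And>i j. i \<in> A \<Longrightarrow> j \<in> A \<Longrightarrow> (i, j) \<in> E\<^sup>*"
    and ER: "\<And>n u i j. u \<in> words A n \<Longrightarrow> (i, j) \<in> E \<Longrightarrow> (u @ [i], u @ [j]) \<in> R (Suc n)"
  shows "\<exists>c>0. \<forall>h\<in>L2 P. ennreal c * lq_norm q (\<lambda>n. s ^ n * sqrt (N ^ n * pair_energy (R n) n h))
     \<le> lq_norm q (\<lambda>n. s ^ n * sqrt (avg_energy (R n) n h / N ^ n))"
proof -
  obtain c where c0: "c \<ge> 0" "\<forall>h n R. h \<in> L2 P \<longrightarrow>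
     R \<subseteq> words A (Suc n) \<times> words A (Suc n) \<longrightarrow> (\<forall>u\<in>words A n. \<forall>(i, j)\<in>E. (u @ [i], u @ [j]) \<in> R) \<longrightarrow>
     resid h n \<le> resid h (Suc n) + c * (avg_energy R (Suc n) h / N ^ Suc n)"
    using resid_recursion[OF E(1)] E(2) by (elim exE conjE meta_impE) auto
  have c: "c \<ge> 0" "resid h n \<le> resid h (Suc n) + c * (avg_energy (R (Suc n)) (Suc n) h / N ^ Suc n)"
    if "h \<in> L2 P" for h n
    using c0(1) c0(2)[rule_format, OF that R(1)] ER by auto
  define r where "r = 1 / s"
  have r: "0 < r" "r < 1" using s by (auto simp: r_def)
  \<comment> \<open>The summand 1 keeps \<open>e\<close> positive, as the Hardy inequality demands,
    even for \<open>c = 0\<close>; it also yields \<open>a n \<le> D * (e * a n)\<close>.\<close>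
  define e where "e = sqrt c + 1"
  have e: "e \<ge> 1" using c0(1) by (simp add: e_def)
  \<comment> \<open>Dominates both coefficients in
    \<open>b n \<le> a n + sqrt (2 * real C) * t n\<close>.\<close>
  define D where "D = 1 + sqrt (2 * real C)"
  have D: "D \<ge> 1" by (simp add: D_def)
  define B where "B = D * (e / (1 - r))"
  have B: "B > 0" using D e r by (simp add: B_def)
  show ?thesis
  proof (intro exI[of _ "1 / B"] conjI ballI)
    show "1 / B > 0" using B by simp
    fix h assume h: "h \<in> L2 P"
    define a where "a n = s ^ n * sqrt (avg_energy (R n) n h / N ^ n)" for n
    define b where "b n = s ^ n * sqrt (N ^ n * pair_energy (R n) n h)" for n
    define t where "t n = s ^ n * sqrt (resid h n)" for n
    \<comment> \<open>The residual at level \<open>n\<close> is controlled by the energy at level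
      \<open>Suc n\<close>. Adding \<open>e * a n\<close> absorbs this shift:
      \<open>t n \<le> r * T (Suc n)\<close>, so the recursion for \<open>T\<close> has
      \<open>a\<close> at the same index as \<open>T\<close>.\<close>
    define T where "T n = t n + e * a n" for n
    have a0: "a n \<ge> 0" for n
      using s N_pos avg_energy_nonneg by (simp add: a_def)
    have t0: "t n \<ge> 0" for n
      using s resid_nonneg[OF h] by (simp add: t_def)
    have b0: "b n \<ge> 0" for n
      using s N_pos pair_energy_nonneg by (simp add: b_def)
    have T0: "T n \<ge> 0" for n
      using a0 t0 e by (simp add: T_def)
    have bT: "b n \<le> D * T n" for n
    proof -
      have "sqrt (N ^ n * pair_energy (R n) n h)
          \<le> sqrt (avg_energy (R n) n h / N ^ n + 2 * real C * resid h n)"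
        using pair_energy_le[OF h R C] by (intro real_sqrt_le_mono)
      also have "\<dots> \<le> sqrt (avg_energy (R n) n h / N ^ n) + sqrt (2 * real C * resid h n)"
        using avg_energy_nonneg N_pos resid_nonneg[OF h] by (intro sqrt_add_le_add_sqrt) auto
      finally have "b n \<le> s ^ n * (sqrt (avg_energy (R n) n h / N ^ n) + sqrt (2 * real C * resid h n))"
        unfolding b_def using s by (intro mult_left_mono) auto
      also have "\<dots> = a n + sqrt (2 * real C) * t n"
        by (simp add: a_def t_def real_sqrt_mult algebra_simps)
      also have "\<dots> \<le> D * (e * a n) + D * t n"
      proof (intro add_mono mult_right_mono t0)
        have "1 \<le> D * e" using D e mult_mono[of 1 D 1 e] by simp
        then show "a n \<le> D * (e * a n)"
          using mult_right_mono[OF _ a0, of 1 "D * e" n] by (simp add: mult.assoc)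
      qed (simp add: D_def)
      finally show ?thesis by (simp add: T_def algebra_simps)
    qed
    have rec: "T n \<le> r * T (Suc n) + e * a n" for n
    proof -
      have "sqrt (resid h n) \<le> sqrt (resid h (Suc n) + c * (avg_energy (R (Suc n)) (Suc n) h / N ^ Suc n))"
        using c(2)[OF h] by (intro real_sqrt_le_mono)
      also have "\<dots> \<le> sqrt (resid h (Suc n)) + sqrt (c * (avg_energy (R (Suc n)) (Suc n) h / N ^ Suc n))"
        using avg_energy_nonneg N_pos resid_nonneg[OF h] c0(1) by (intro sqrt_add_le_add_sqrt) auto
      also have "\<dots> \<le> sqrt (resid h (Suc n)) + e * sqrt (avg_energy (R (Suc n)) (Suc n) h / N ^ Suc n)"
        unfolding real_sqrt_mult[of c] e_def
        using avg_energy_nonneg N_pos by (intro add_left_mono mult_right_mono) auto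
      finally have "t n \<le> s ^ n * (sqrt (resid h (Suc n)) + e * sqrt (avg_energy (R (Suc n)) (Suc n) h / N ^ Suc n))"
        unfolding t_def using s by (intro mult_left_mono) auto
      also have "\<dots> = r * T (Suc n)"
        using s by (simp add: r_def T_def t_def a_def field_simps)
      finally show ?thesis by (simp add: T_def)
    qed
    \<comment> \<open>The factor \<open>r ^ k\<close> cancels the weight: what remains is the square
      root of the residual, which tends to 0, plus a bounded sequence times
      \<open>r ^ k\<close>.\<close>
    have lim: "(\<lambda>k. r ^ k * T k) \<longlonglongrightarrow> 0" if bd: "bounded (range a)"
    proof -
      obtain Z where Z: "\<And>n. norm (a n) \<le> Z"
        using bd by (auto simp: bounded_iff)
      have "(\<lambda>k. r ^ k * Z) \<longlonglongrightarrow> 0 * Z"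
        using r by (intro tendsto_mult tendsto_const LIMSEQ_realpow_zero) auto
      then have "(\<lambda>k. r ^ k * Z) \<longlonglongrightarrow> 0" by simp
      then have "(\<lambda>k. r ^ k * a k) \<longlonglongrightarrow> 0"
      proof (rule tendsto_sandwich[OF _ _ tendsto_const, rotated 2])
        show "\<forall>\<^sub>F k in sequentially. 0 \<le> r ^ k * a k"
          using r a0 by simp
        have "r ^ k * a k \<le> r ^ k * Z" for k
          using Z[of k] r by (intro mult_left_mono) auto
        then show "\<forall>\<^sub>F k in sequentially. r ^ k * a k \<le> r ^ k * Z"
          by simp
      qed
      then have "(\<lambda>k. sqrt (resid h k) + e * (r ^ k * a k)) \<longlonglongrightarrow> sqrt 0 + e * 0"
        by (intro tendsto_add tendsto_mult tendsto_const tendsto_real_sqrt resid_tendsto_0 h)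
      moreover have "r ^ k * T k = sqrt (resid h k) + e * (r ^ k * a k)" for k
        using s by (simp add: T_def t_def r_def power_one_over field_simps)
      ultimately show ?thesis by simp
    qed
    have "lq_norm q b \<le> lq_norm q (\<lambda>n. D * T n)"
      using bT b0 by (intro lq_norm_mono q) (use D T0 in \<open>simp add: abs_mult\<close>)
    also have "\<dots> = ennreal D * lq_norm q T"
      using D by (intro lq_norm_cmult q) auto
    also have "\<dots> \<le> ennreal D * (ennreal (e / (1 - r)) * lq_norm q a)"
      using e by (intro mult_left_mono lq_norm_backward_recursion[OF q r _ T0 a0 rec lim]) auto
    also have "\<dots> = ennreal B * lq_norm q a"
      unfolding B_def using D e r by (subst ennreal_mult) (auto simp: mult.assoc)
    finally have "ennreal (1 / B) * lq_norm q b \<le> ennreal (1 / B) * (ennreal B * lq_norm q a)"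
      by (intro mult_left_mono) auto
    also have "\<dots> = lq_norm q a"
      using B by (simp add: flip: mult.assoc ennreal_mult)
    finally show "ennreal (1 / B) * lq_norm q (\<lambda>n. s ^ n * sqrt (N ^ n * pair_energy (R n) n h))
        \<le> lq_norm q (\<lambda>n. s ^ n * sqrt (avg_energy (R n) n h / N ^ n))"
      unfolding a_def b_def .
  qed
qed

end

section \<open>Coding of self-similar sets\<close>

lemma cell_append: "cell F B (u @ v) = foldr F u ` cell F B v"
  by (auto simp: cell_def)

text \<open>Prefixing \<open>u\<close> maps all cells of a chain by \<open>foldr F u\<close>, and
  intersecting sets have intersecting images.\<close>

lemma nbhd_append:
  assumes u: "u \<in> words W m" and v: "v \<in> nbhd F K W n k {w}"
  shows "u @ v \<in> nbhd F K W (m + n) k {u @ w}"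
  using v
proof (induction k arbitrary: v)
  case (Suc k)
  then obtain x where x: "v \<in> words W n" "x \<in> nbhd F K W n k {w}" "cell F K v \<inter> cell F K x \<noteq> {}"
    by auto
  then have "cell F K (u @ v) \<inter> cell F K (u @ x) \<noteq> {}"
    unfolding cell_append by blast
  then show ?case
    using append_mem_words[OF u x(1)] Suc.IH[OF x(2)] by auto
qed simp

text \<open>Exhibits neighbourhoods of a word as powers of a symmetric relation, from which
  \<open>linked_sym\<close> follows. For \<open>k = 0\<close> the definition of \<open>nbhd\<close>
  does not confine the set to \<open>words W n\<close>, hence the assumption on
  \<open>w\<close>.\<close>

lemma nbhd_eq_relpow:
  assumes "w \<in> words W n"
  shows "nbhd F K W n k {w} =
    {v. (w, v) \<in> {(x, y). x \<in> words W n \<and> y \<in> words W n \<and> cell F K x \<inter> cell F K y \<noteq> {}} ^^ k}"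
    (is "_ = {v. (w, v) \<in> ?R ^^ k}")
proof (induction k)
  case (Suc k)
  have "nbhd F K W n k {w} \<subseteq> words W n"
    using assms by (cases k) auto
  then show ?case
    using Suc by (auto simp: relcomp_unfold Int_commute)
qed auto

lemma relpow_symD: "sym R \<Longrightarrow> (x, y) \<in> R ^^ k \<Longrightarrow> (y, x) \<in> R ^^ k"
proof (induction k arbitrary: y)
  case (Suc k)
  from Suc.prems(2) obtain z where "(x, z) \<in> R ^^ k" "(z, y) \<in> R"
    by (rule relpow_Suc_E)
  with Suc.IH Suc.prems(1) show ?case
    by (intro relpow_Suc_I2[of y z]) (auto dest: symD)
qed simp

lemma linked_sym:
  assumes "I \<subseteq> W" "linked F K W I M n v w"
  shows "linked F K W I M n w v"
proof -
  have "v \<in> words W n" "w \<in> words W n"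
    using assms by (auto simp: linked_def words_def)
  moreover have "sym {(x, y). x \<in> words W n \<and> y \<in> words W n \<and> cell F K x \<inter> cell F K y \<noteq> {}}"
    by (auto simp: sym_def)
  ultimately show ?thesis
    using assms(2) by (auto simp: linked_def nbhd_eq_relpow intro: relpow_symD)
qed

text \<open>Copies the links between single letters to the children of an arbitrary word, as
  \<open>resid_recursion\<close> requires.\<close>

lemma linked_append:
  assumes "I \<subseteq> W" "u \<in> words I m" "linked F K W I M n v w"
  shows "linked F K W I M (m + n) (u @ v) (u @ w)"
proof -
  have "u \<in> words W m" using assms(1,2) by (auto simp: words_def)
  then show ?thesis
    using assms by (auto simp: linked_def append_mem_words nbhd_append)
qed

section \<open>Addresses and the coding map of the subsystem indexed by \<open>I\<close>\<close>

locale self_similar =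
  fixes F :: "'i \<Rightarrow> 'a::polish_space \<Rightarrow> 'a" and K L :: "'a set" and I :: "'i set" and \<alpha> :: real
  assumes alpha: "\<alpha> > 1" and finite_I: "finite I"
    and similitude: "\<And>i x y. i \<in> I \<Longrightarrow> dist (F i x) (F i y) = dist x y / \<alpha>"
    and compact_K: "compact K" and K_nonempty: "K \<noteq> {}"
    and F_K: "\<And>i. i \<in> I \<Longrightarrow> F i ` K \<subseteq> K"
    and compact_L: "compact L" and L_nonempty: "L \<noteq> {}" and L_eq: "L = (\<Union>i\<in>I. F i ` L)"
begin

lemma I_nonempty: "I \<noteq> {}"
  using L_nonempty L_eq by auto

sublocale bernoulli I
  using finite_I I_nonempty by unfold_locales

lemma F_L: "i \<in> I \<Longrightarrow> F i ` L \<subseteq> L"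
  using L_eq by blast

lemma dist_foldr: "set w \<subseteq> I \<Longrightarrow> dist (foldr F w x) (foldr F w y) = dist x y / \<alpha> ^ length w"
  by (induction w) (auto simp: similitude)

lemma foldr_invariant: "set w \<subseteq> I \<Longrightarrow> (\<And>i. i \<in> I \<Longrightarrow> F i ` B \<subseteq> B) \<Longrightarrow> x \<in> B \<Longrightarrow> foldr F w x \<in> B"
  by (induction w) (auto simp: image_subset_iff)

lemma small_dist_eventually: "(\<lambda>m. C / \<alpha> ^ m) \<longlonglongrightarrow> 0"
proof -
  have "(\<lambda>m. C * (1 / \<alpha>) ^ m) \<longlonglongrightarrow> C * 0"
    using alpha by (intro tendsto_mult tendsto_const LIMSEQ_realpow_zero) auto
  then show ?thesis by (simp add: power_divide)
qed

text \<open>By self-similarity every point of \<open>L\<close> has a first letter and a preimage in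
  \<open>L\<close>; iterating one such choice produces the letters of \<open>\<omega>\<close> and
  the remainders \<open>z m\<close>.\<close>

lemma L_address:
  assumes "y \<in> L"
  obtains \<omega> z where "range \<omega> \<subseteq> I" "\<And>m. z m \<in> L" "\<And>m. y = foldr F (map \<omega> [0..<m]) (z m)"
proof -
  have "\<forall>y\<in>L. \<exists>i x. i \<in> I \<and> x \<in> L \<and> y = F i x"
    using L_eq by blast
  then obtain i x where ix: "\<And>y. y \<in> L \<Longrightarrow> i y \<in> I \<and> x y \<in> L \<and> y = F (i y) (x y)"
    by metis
  define z where "z m = (x ^^ m) y" for m
  have z: "z m \<in> L" for m
    by (induction m) (auto simp: z_def assms ix)
  have "y = foldr F (map (\<lambda>m. i (z m)) [0..<m]) (z m)" for m
  proof (induction m)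
    case (Suc m)
    have "z m = F (i (z m)) (z (Suc m))"
      using ix[OF z[of m]] by (simp add: z_def)
    then show ?case using Suc by simp
  qed (simp add: z_def)
  with z ix show thesis
    by (intro that[of "\<lambda>m. i (z m)" z]) auto
qed

text \<open>The maps along an address of \<open>y\<close>, applied to one point of \<open>K\<close>,
  give points of \<open>K\<close> converging to \<open>y\<close>, and \<open>K\<close> is
  closed.\<close>

lemma L_subset_K: "L \<subseteq> K"
proof
  fix y assume "y \<in> L"
  then obtain \<omega> z where z: "range \<omega> \<subseteq> I" "\<And>m. z m \<in> L" "\<And>m. y = foldr F (map \<omega> [0..<m]) (z m)"
    by (rule L_address) blast
  obtain x where x: "x \<in> K" using K_nonempty by blast
  obtain C where C: "\<And>u. u \<in> L \<Longrightarrow> dist x u \<le> C"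
    using compact_imp_bounded[OF compact_L] by (auto simp: bounded_any_center[of _ x] )
  have lim: "(\<lambda>m. foldr F (map \<omega> [0..<m]) x) \<longlonglongrightarrow> y"
  proof (rule metric_tendsto_imp_tendsto[OF small_dist_eventually[of C]])
    have "dist (foldr F (map \<omega> [0..<m]) x) y \<le> C / \<alpha> ^ m" for m
      using z(1) C[OF z(2)[of m]] alpha
      by (subst z(3)[of m], subst dist_foldr) (auto intro!: divide_right_mono)
    then show "\<forall>\<^sub>F m in sequentially. dist (foldr F (map \<omega> [0..<m]) x) y \<le> dist (C / \<alpha> ^ m) 0"
      unfolding dist_real_def diff_0_right
      by (intro always_eventually allI order_trans[OF _ abs_ge_self])
  qed
  have "foldr F (map \<omega> [0..<m]) x \<in> K" for m
    using z(1) F_K x by (intro foldr_invariant) auto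
  then show "y \<in> K"
    by (rule closed_sequentially[OF compact_imp_closed[OF compact_K] _ lim])
qed

lemma cell_prefix_antimono:
  assumes "range \<omega> \<subseteq> I" "\<And>i. i \<in> I \<Longrightarrow> F i ` B \<subseteq> B"
  shows "cell F B (map \<omega> [0..<m + k]) \<subseteq> cell F B (map \<omega> [0..<m])"
proof -
  have "map \<omega> [0..<m + k] = map \<omega> [0..<m] @ map \<omega> [m..<m + k]"
    by (simp flip: map_append upt_add_eq_append)
  moreover have "cell F B (map \<omega> [m..<m + k]) \<subseteq> B"
    using foldr_invariant[OF _ assms(2)] assms(1) by (auto simp: cell_def image_subset_iff)
  ultimately show ?thesis
    by (auto simp: cell_append cell_def)
qed

lemma compact_cell:
  assumes "set w \<subseteq> I"
  shows "compact (cell F L w)"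
  unfolding cell_def
proof (rule compact_continuous_image[OF _ compact_L])
  have "dist (foldr F w x) (foldr F w y) \<le> 1 * dist x y" for x y
    using dist_foldr[OF assms] alpha by (simp add: divide_le_eq mult_le_cancel_left1)
  then have "1-lipschitz_on L (foldr F w)"
    by (intro lipschitz_onI) auto
  then show "continuous_on L (foldr F w)"
    by (rule lipschitz_on_continuous_on)
qed

text \<open>The diameters of the cells along \<open>\<omega>\<close> are at most
  \<open>C / \<alpha> ^ m\<close>, so a common point is unique and the description in
  \<open>coding\<close> is proper.\<close>

lemma coding_eqI:
  assumes \<omega>: "range \<omega> \<subseteq> I" and x: "\<And>m. x \<in> cell F K (map \<omega> [0..<m])"
  shows "coding F K \<omega> = x"
proof -
  obtain C where C: "\<And>u v. u \<in> K \<Longrightarrow> v \<in> K \<Longrightarrow> dist u v \<le> C"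
    using compact_imp_bounded[OF compact_K] by (meson bounded_two_points)
  have "y = x" if y: "\<And>m. y \<in> cell F K (map \<omega> [0..<m])" for y
  proof -
    have "dist y x \<le> C / \<alpha> ^ m" for m
    proof -
      obtain u v where "u \<in> K" "v \<in> K" "y = foldr F (map \<omega> [0..<m]) u" "x = foldr F (map \<omega> [0..<m]) v"
        using x[of m] y[of m] by (auto simp: cell_def)
      then show ?thesis
        using C[of u v] \<omega> alpha by (auto simp: dist_foldr image_subset_iff intro!: divide_right_mono)
    qed
    then have "dist y x \<le> 0"
      by (intro LIMSEQ_le_const[OF small_dist_eventually]) auto
    then show ?thesis by simp
  qed
  then have "(\<Inter>m. cell F K (map \<omega> [0..<m])) = {x}"
    using x by blast
  then show ?thesis
    by (simp add: coding_def)
qed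

text \<open>The decreasing compact cells of \<open>L\<close> have a common point. It also lies in
  the cells of \<open>K\<close>, by which \<open>coding\<close> is defined, hence it is the coded
  point.\<close>

lemma coding_mem_cell:
  assumes \<omega>: "range \<omega> \<subseteq> I"
  shows "coding F K \<omega> \<in> cell F L (map \<omega> [0..<m])"
proof -
  have sub: "cell F L (map \<omega> [0..<n]) \<subseteq> cell F L (map \<omega> [0..<m])" if "m \<le> n" for m n
    using cell_prefix_antimono[OF \<omega> F_L, of m "n - m"] that by simp
  have "L \<inter> (\<Inter>m\<in>UNIV. cell F L (map \<omega> [0..<m])) \<noteq> {}"
  proof (rule compact_imp_fip_image[OF compact_L])
    show "closed (cell F L (map \<omega> [0..<m]))" for m
      using \<omega> by (intro compact_imp_closed compact_cell) auto
    fix T :: "nat set" assume T: "finite T"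
    obtain b where b: "\<forall>m\<in>T. m < b"
      using T unfolding finite_nat_set_iff_bounded by (elim exE)
    have "cell F L (map \<omega> [0..<b]) \<noteq> {}"
      using L_nonempty by (simp add: cell_def)
    moreover have "cell F L (map \<omega> [0..<b]) \<subseteq> L"
      using sub[of 0 b] by (simp add: cell_def)
    moreover have "cell F L (map \<omega> [0..<b]) \<subseteq> (\<Inter>m\<in>T. cell F L (map \<omega> [0..<m]))"
      by (intro INT_greatest sub) (use b in auto)
    ultimately show "L \<inter> (\<Inter>m\<in>T. cell F L (map \<omega> [0..<m])) \<noteq> {}"
      by blast
  qed
  then obtain x where x: "\<And>m. x \<in> cell F L (map \<omega> [0..<m])" by blast
  then have "\<And>m. x \<in> cell F K (map \<omega> [0..<m])"
    using L_subset_K by (auto simp: cell_def)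
  from coding_eqI[OF \<omega> this] x show ?thesis by simp
qed

lemma coding_mem_L: "range \<omega> \<subseteq> I \<Longrightarrow> coding F K \<omega> \<in> L"
  using coding_mem_cell[of \<omega> 0] by (simp add: cell_def)

lemma coding_mem_cell_K: "range \<omega> \<subseteq> I \<Longrightarrow> coding F K \<omega> \<in> cell F K (map \<omega> [0..<m])"
  using coding_mem_cell[of \<omega> m] L_subset_K by (auto simp: cell_def)

text \<open>The right-hand side lies in the cell of the prefix of length \<open>m + k\<close>, hence
  in the larger cell of length \<open>m\<close>, for every \<open>m\<close>.\<close>

lemma coding_shift:
  assumes \<omega>: "range \<omega> \<subseteq> I"
  shows "coding F K \<omega> = foldr F (map \<omega> [0..<k]) (coding F K (\<lambda>n. \<omega> (k + n)))"
proof (rule coding_eqI[OF \<omega>])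
  fix m
  have shift: "range (\<lambda>n. \<omega> (k + n)) \<subseteq> I" using \<omega> by auto
  have "map \<omega> [0..<m + k] = map \<omega> [0..<k] @ map (\<lambda>n. \<omega> (k + n)) [0..<m]"
    by (rule nth_equalityI) (auto simp: nth_append)
  then have "foldr F (map \<omega> [0..<k]) (coding F K (\<lambda>n. \<omega> (k + n))) \<in> cell F K (map \<omega> [0..<m + k])"
    using coding_mem_cell_K[OF shift, of m] by (auto simp: cell_append)
  then show "foldr F (map \<omega> [0..<k]) (coding F K (\<lambda>n. \<omega> (k + n))) \<in> cell F K (map \<omega> [0..<m])"
    using cell_prefix_antimono[OF \<omega> F_K, of m k] by blast
qed

lemma coding_surj:
  assumes "y \<in> L"
  obtains \<omega> where "range \<omega> \<subseteq> I" "coding F K \<omega> = y"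
proof -
  from assms obtain \<omega> z where z: "range \<omega> \<subseteq> I" "\<And>m. z m \<in> L" "\<And>m. y = foldr F (map \<omega> [0..<m]) (z m)"
    by (rule L_address) blast
  have "y \<in> cell F K (map \<omega> [0..<m])" for m
  proof -
    have "foldr F (map \<omega> [0..<m]) (z m) \<in> cell F K (map \<omega> [0..<m])"
      using z(2) L_subset_K by (auto simp: cell_def)
    then show ?thesis unfolding z(3)[of m, symmetric] .
  qed
  then have "coding F K \<omega> = y"
    by (rule coding_eqI[OF z(1)])
  with z(1) show thesis by (rule that)
qed

text \<open>The coding map is a pointwise limit of functions of finitely many letters, namely the
  images of one point of \<open>L\<close>.\<close>

lemma coding_measurable [measurable]: "coding F K \<in> measurable P (restrict_space borel L)"
proof (rule measurable_restrict_space2)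
  show "coding F K \<in> space P \<rightarrow> L"
    by (auto simp: space_P coding_mem_L)
  obtain x where x: "x \<in> L" using L_nonempty by blast
  obtain C where C: "\<And>u. u \<in> L \<Longrightarrow> dist x u \<le> C"
    using compact_imp_bounded[OF compact_L] by (auto simp: bounded_any_center[of _ x])
  show "coding F K \<in> borel_measurable P"
  proof (rule borel_measurable_LIMSEQ_metric)
    show "(\<lambda>\<omega>. foldr F (map \<omega> [0..<m]) x) \<in> borel_measurable P" for m
      by (rule prefix_fun_measurable)
    fix \<omega> assume "\<omega> \<in> space P"
    then have \<omega>: "range \<omega> \<subseteq> I" by (simp add: space_P)
    show "(\<lambda>m. foldr F (map \<omega> [0..<m]) x) \<longlonglongrightarrow> coding F K \<omega>"
    proof (rule metric_tendsto_imp_tendsto[OF small_dist_eventually[of C]])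
      have "dist (foldr F (map \<omega> [0..<m]) x) (coding F K \<omega>) \<le> C / \<alpha> ^ m" for m
        using \<omega> C[OF coding_mem_L[of "\<lambda>n. \<omega> (m + n)"]] alpha
        by (subst coding_shift[OF \<omega>, of m], subst dist_foldr) (auto intro!: divide_right_mono)
      then show "\<forall>\<^sub>F m in sequentially. dist (foldr F (map \<omega> [0..<m]) x) (coding F K \<omega>) \<le> dist (C / \<alpha> ^ m) 0"
        unfolding dist_real_def diff_0_right
        by (intro always_eventually allI order_trans[OF _ abs_ge_self])
    qed
  qed
qed

section \<open>Points with infinitely many addresses and the image measure on
  \<open>L\<close>\<close>

abbreviation \<nu> :: "'a measure" where
  "\<nu> \<equiv> bernoulli_image F K I L"

lemma nu_eq: "\<nu> = distr P (restrict_space borel L) (coding F K)"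
  by (simp add: bernoulli_image_def)

text \<open>If a point of the cell of \<open>w\<close> recurs along the shifts of \<open>\<omega>\<close> at times where \<open>\<omega>\<close> itself does not
  continue with \<open>w\<close>, then each such time yields a further address of \<open>coding F K \<omega>\<close>: follow \<open>\<omega>\<close> up to
  that time and then continue with \<open>w\<close>.\<close>

lemma infinite_addresses:
  assumes \<omega>: "range \<omega> \<subseteq> I" and w: "w \<in> words I n"
    and inf: "infinite {k. map (\<lambda>m. \<omega> (k + m)) [0..<n] \<noteq> w \<and> coding F K (\<lambda>m. \<omega> (k + m)) \<in> cell F L w}"
  shows "infinite {\<tau>. range \<tau> \<subseteq> I \<and> coding F K \<tau> = coding F K \<omega>}"
proof
  assume fin: "finite {\<tau>. range \<tau> \<subseteq> I \<and> coding F K \<tau> = coding F K \<omega>}" (is "finite ?T")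
  \<comment> \<open>Position of the first disagreement with \<open>\<omega>\<close>. For
    \<open>\<tau> = \<omega>\<close> the \<open>LEAST\<close> has no witness and its value is
    unspecified, but the bound on the finite image covers it too.\<close>
  define first where "first \<tau> = (LEAST i. \<tau> i \<noteq> \<omega> i)" for \<tau>
  have "finite (first ` ?T)" using fin by simp
  then obtain b where "\<forall>i\<in>first ` ?T. i < b"
    unfolding finite_nat_set_iff_bounded by (elim exE)
  then have b: "first \<tau> < b" if "\<tau> \<in> ?T" for \<tau>
    using that by (rule bspec[OF _ imageI])
  obtain k where k: "k > b" "map (\<lambda>m. \<omega> (k + m)) [0..<n] \<noteq> w" "coding F K (\<lambda>m. \<omega> (k + m)) \<in> cell F L w"
    using inf unfolding infinite_nat_iff_unbounded by blast
  then obtain y where y: "y \<in> L" "coding F K (\<lambda>m. \<omega> (k + m)) = foldr F w y"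
    by (auto simp: cell_def)
  obtain \<sigma> where \<sigma>: "range \<sigma> \<subseteq> I" "coding F K \<sigma> = y"
    using coding_surj[OF y(1)] by blast
  have len: "length w = n" using w by (rule length_words)
  \<comment> \<open>Follow \<open>\<omega>\<close> up to a recurrence time \<open>k\<close> beyond
    all first disagreements, then \<open>w\<close>, then an address of \<open>y\<close>. The code is
    the same, but the first disagreement comes too late.\<close>
  define \<tau> where "\<tau> i = (if i < k then \<omega> i else if i < k + n then w ! (i - k) else \<sigma> (i - (k + n)))" for i
  have \<tau>: "range \<tau> \<subseteq> I"
    using \<omega> \<sigma>(1) w len by (auto simp: \<tau>_def words_def subset_iff image_iff)
  have "coding F K \<tau> = foldr F (map \<tau> [0..<k + n]) (coding F K (\<lambda>m. \<tau> (k + n + m)))"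
    by (rule coding_shift[OF \<tau>])
  also have "map \<tau> [0..<k + n] = map \<omega> [0..<k] @ w"
    by (rule nth_equalityI) (auto simp: \<tau>_def nth_append len)
  also have "(\<lambda>m. \<tau> (k + n + m)) = \<sigma>"
    by (auto simp: \<tau>_def)
  also have "foldr F (map \<omega> [0..<k] @ w) (coding F K \<sigma>) = coding F K \<omega>"
    using coding_shift[OF \<omega>, of k] y(2) \<sigma>(2) by simp
  finally have T: "\<tau> \<in> ?T" using \<tau> by simp
  have "\<tau> \<noteq> \<omega>"
  proof
    assume "\<tau> = \<omega>"
    then have "\<omega> (k + i) = w ! i" if "i < n" for i
      using that by (auto simp: \<tau>_def fun_eq_iff dest: spec[of _ "k + i"])
    then have "map (\<lambda>m. \<omega> (k + m)) [0..<n] = w"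
      using len by (intro nth_equalityI) auto
    with k(2) show False by simp
  qed
  then obtain i where "\<tau> i \<noteq> \<omega> i" by blast
  then have "\<tau> (first \<tau>) \<noteq> \<omega> (first \<tau>)"
    unfolding first_def by (rule LeastI)
  then have "first \<tau> \<ge> k"
    by (auto simp: \<tau>_def split: if_splits)
  with b[OF T] k(1) show False by simp
qed

lemma sets_cell: "w \<in> words I n \<Longrightarrow> cell F L w \<in> sets (restrict_space borel L)"
proof -
  assume w: "w \<in> words I n"
  then have "cell F L w \<subseteq> L"
    using F_L by (auto simp: cell_def words_def intro!: foldr_invariant)
  moreover have "cell F L w \<in> sets borel"
    using w by (intro borel_closed compact_imp_closed compact_cell) (simp add: words_def)
  ultimately show ?thesis
    using compact_imp_closed[OF compact_L] by (subst sets_restrict_space_iff) (auto simp: borel_closed)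
qed

lemma vimage_cell_sets [measurable]: "w \<in> words I n \<Longrightarrow> coding F K -` cell F L w \<inter> space P \<in> sets P"
  by (intro measurable_sets[OF coding_measurable] sets_cell)

lemma L2_coding:
  assumes "f \<in> L2 \<nu>"
  shows "(\<lambda>\<omega>. f (coding F K \<omega>)) \<in> L2 P"
  using assms unfolding L2_def nu_eq
  by (auto simp: integrable_distr_eq intro: measurable_compose[OF coding_measurable])

section \<open>Cells agree with cylinders almost surely\<close>

context
  assumes null: "{x \<in> L. infinite {\<omega>. range \<omega> \<subseteq> I \<and> coding F K \<omega> = x}} \<in> null_sets \<nu>"
begin

text \<open>The exceptional event \<open>B\<close> consists of sequences coded into the cell of
  \<open>w\<close> without starting with \<open>w\<close>. If infinitely many shifts hit
  \<open>B\<close>, the coded point has infinitely many addresses, which is a null event by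
  \<open>null\<close>; so \<open>B\<close> itself is null by recurrence.\<close>

lemma AE_coding_mem_cell_iff:
  assumes w: "w \<in> words I n"
  shows "AE \<omega> in P. coding F K \<omega> \<in> cell F L w \<longleftrightarrow> map \<omega> [0..<n] = w"
proof -
  define B where "B = coding F K -` cell F L w \<inter> space P - cyl I w"
  define X where "X = {x \<in> L. infinite {\<omega>. range \<omega> \<subseteq> I \<and> coding F K \<omega> = x}}"
  have B: "B = {\<omega>. range \<omega> \<subseteq> I \<and> map \<omega> [0..<n] \<noteq> w \<and> coding F K \<omega> \<in> cell F L w}"
    by (auto simp: B_def cyl_eq[OF w] space_P)
  have "B \<in> null_sets P"
  proof (rule null_if_null_recurrence)
    show "B \<in> sets P"
      unfolding B_def by (intro sets.Diff vimage_cell_sets[OF w] sets_cyl[OF w])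
    show "coding F K -` X \<inter> space P \<in> null_sets P"
      using null null_sets_distr_iff[OF coding_measurable] by (simp add: nu_eq X_def)
    show "{\<omega> \<in> space P. infinite {k. (\<lambda>m. \<omega> (k + m)) \<in> B}} \<subseteq> coding F K -` X \<inter> space P"
    proof safe
      fix \<omega> assume \<omega>: "\<omega> \<in> space P" and inf: "infinite {k. (\<lambda>m. \<omega> (k + m)) \<in> B}"
      have r: "range \<omega> \<subseteq> I" using \<omega> by (simp add: space_P)
      have "{k. (\<lambda>m. \<omega> (k + m)) \<in> B} =
          {k. map (\<lambda>m. \<omega> (k + m)) [0..<n] \<noteq> w \<and> coding F K (\<lambda>m. \<omega> (k + m)) \<in> cell F L w}"
        using r by (auto simp: B image_subset_iff)
      with infinite_addresses[OF r w] inf have "infinite {\<tau>. range \<tau> \<subseteq> I \<and> coding F K \<tau> = coding F K \<omega>}"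
        by simp
      then show "\<omega> \<in> coding F K -` X"
        using coding_mem_L[OF r] by (simp add: X_def)
    qed
  qed
  then have "AE \<omega> in P. \<omega> \<notin> B" by (rule AE_not_in)
  then show ?thesis
  proof (rule AE_mp, intro AE_I2 impI)
    fix \<omega> assume "\<omega> \<in> space P" "\<omega> \<notin> B"
    then show "coding F K \<omega> \<in> cell F L w \<longleftrightarrow> map \<omega> [0..<n] = w"
      using coding_mem_cell[of \<omega> n] by (auto simp: B space_P)
  qed
qed

lemma measure_cell:
  assumes w: "w \<in> words I n"
  shows "measure \<nu> (cell F L w) = 1 / N ^ n"
proof -
  have "measure \<nu> (cell F L w) = measure P (coding F K -` cell F L w \<inter> space P)"
    unfolding nu_eq by (rule measure_distr[OF coding_measurable sets_cell[OF w]])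
  also have "\<dots> = measure P (cyl I w)"
  proof (rule finite_measure_eq_AE[OF _ vimage_cell_sets[OF w] sets_cyl[OF w]])
    show "AE \<omega> in P. (\<omega> \<in> coding F K -` cell F L w \<inter> space P) = (\<omega> \<in> cyl I w)"
      using AE_coding_mem_cell_iff[OF w] by (rule AE_mp) (auto simp: cyl_eq[OF w])
  qed
  finally show ?thesis using measure_cyl[OF w] by simp
qed

text \<open>After the change of variables the indicators of the cell and of the cylinder agree
  almost surely, and the cell has measure \<open>1 / N ^ n\<close>.\<close>

lemma cell_avg_eq:
  assumes f: "f \<in> L2 \<nu>" and w: "w \<in> words I n"
  shows "cell_avg F L \<nu> f w = N ^ n * mass (\<lambda>\<omega>. f (coding F K \<omega>)) w"
proof -
  have fm: "f \<in> borel_measurable (restrict_space borel L)"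
    using f by (simp add: L2_def nu_eq)
  have im: "(\<lambda>x. indicator (cell F L w) x *\<^sub>R f x) \<in> borel_measurable (restrict_space borel L)"
    using sets_cell[OF w] fm by (intro borel_measurable_scaleR borel_measurable_indicator)
  have "(LINT x:cell F L w|\<nu>. f x) = (LINT \<omega>|P. indicator (cell F L w) (coding F K \<omega>) *\<^sub>R f (coding F K \<omega>))"
    unfolding set_lebesgue_integral_def nu_eq by (rule integral_distr[OF coding_measurable im])
  also have "\<dots> = mass (\<lambda>\<omega>. f (coding F K \<omega>)) w"
    unfolding mass_def
  proof (rule integral_cong_AE)
    show "(\<lambda>\<omega>. indicator (cell F L w) (coding F K \<omega>) *\<^sub>R f (coding F K \<omega>)) \<in> borel_measurable P"
      by (rule measurable_compose[OF coding_measurable im])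
    show "(\<lambda>\<omega>. indicator (cyl I w) \<omega> * f (coding F K \<omega>)) \<in> borel_measurable P"
      using integrable_cyl[OF w L2_integrable[OF L2_coding[OF f]]] by auto
    show "AE \<omega> in P. indicator (cell F L w) (coding F K \<omega>) *\<^sub>R f (coding F K \<omega>)
        = indicator (cyl I w) \<omega> * f (coding F K \<omega>)"
      using AE_coding_mem_cell_iff[OF w]
      by (rule AE_mp) (auto simp: cyl_eq[OF w] indicator_def)
  qed
  finally show ?thesis
    using measure_cell[OF w] by (simp add: cell_avg_def)
qed

end

section \<open>Double integrals over \<open>L\<close> as integrals over pairs of sequences\<close>

lemma near_energy_eq:
  assumes f: "f \<in> L2 \<nu>"
  shows "near_energy L \<nu> r f = (LINT z|(P \<Otimes>\<^sub>M P).
     indicator {(x, y). dist (coding F K x) (coding F K y) < r} z * (f (coding F K (fst z)) - f (coding F K (snd z)))\<^sup>2)"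
    and "{z \<in> space (P \<Otimes>\<^sub>M P). dist (coding F K (fst z)) (coding F K (snd z)) < r} \<in> sets (P \<Otimes>\<^sub>M P)"
proof -
  let ?B = "restrict_space borel L"
  have fm [measurable]: "f \<in> borel_measurable ?B"
    using f by (simp add: L2_def nu_eq)
  have id [measurable]: "(\<lambda>x. x) \<in> borel_measurable ?B"
    by (rule measurable_restrict_space1) simp
  have cod [measurable]: "coding F K \<in> borel_measurable P"
    using measurable_compose[OF coding_measurable id] by simp
  show "{z \<in> space (P \<Otimes>\<^sub>M P). dist (coding F K (fst z)) (coding F K (snd z)) < r} \<in> sets (P \<Otimes>\<^sub>M P)"
    by measurable
  interpret D: prob_space "distr P ?B (coding F K)"
    by (rule prob_space_distr[OF coding_measurable])
  \<comment> \<open>The product of two image measures is the image of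
    \<open>P \<Otimes>\<^sub>M P\<close> under the coding map in both coordinates.\<close>
  have nn: "\<nu> \<Otimes>\<^sub>M \<nu> = distr (P \<Otimes>\<^sub>M P) (?B \<Otimes>\<^sub>M ?B) (\<lambda>z. (coding F K (fst z), coding F K (snd z)))"
    using pair_measure_distr[OF coding_measurable coding_measurable D.sigma_finite_measure_axioms]
    by (simp add: nu_eq case_prod_unfold)
  have m: "(\<lambda>z. if dist (fst z) (snd z) < r then \<bar>f (fst z) - f (snd z)\<bar>\<^sup>2 else 0) \<in> borel_measurable (?B \<Otimes>\<^sub>M ?B)"
    by measurable
  have "near_energy L \<nu> r f = (LINT z|(\<nu> \<Otimes>\<^sub>M \<nu>). (if dist (fst z) (snd z) < r then \<bar>f (fst z) - f (snd z)\<bar>\<^sup>2 else 0))"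
    unfolding near_energy_def set_lebesgue_integral_def
    by (intro Bochner_Integration.integral_cong)
       (auto simp: nn space_pair_measure space_restrict_space indicator_def)
  also have "\<dots> = (LINT z|(P \<Otimes>\<^sub>M P). (if dist (coding F K (fst z)) (coding F K (snd z)) < r
      then \<bar>f (coding F K (fst z)) - f (coding F K (snd z))\<bar>\<^sup>2 else 0))"
    unfolding nn using integral_distr[OF _ m, of "\<lambda>z. (coding F K (fst z), coding F K (snd z))" "P \<Otimes>\<^sub>M P"]
    by (simp cong: if_cong)
  also have "\<dots> = (LINT z|(P \<Otimes>\<^sub>M P).
     indicator {(x, y). dist (coding F K x) (coding F K y) < r} z * (f (coding F K (fst z)) - f (coding F K (snd z)))\<^sup>2)"
    by (intro Bochner_Integration.integral_cong) (auto simp: indicator_def case_prod_unfold)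
  finally show "near_energy L \<nu> r f = \<dots>" .
qed

text \<open>Only pairs of words over \<open>I\<close> matter, so the set is a finite union of
  products of cylinders, whatever \<open>R\<close> is.\<close>

lemma pair_prefix_sets: "{z \<in> space (P \<Otimes>\<^sub>M P). (map (fst z) [0..<n], map (snd z) [0..<n]) \<in> R} \<in> sets (P \<Otimes>\<^sub>M P)"
proof -
  have "{z \<in> space (P \<Otimes>\<^sub>M P). (map (fst z) [0..<n], map (snd z) [0..<n]) \<in> R}
      = (\<Union>(v, w)\<in>R \<inter> words I n \<times> words I n. cyl I v \<times> cyl I w)"
    by (auto simp: space_pair_measure space_P cyl_def length_words prefix_mem_words)
  also have "\<dots> \<in> sets (P \<Otimes>\<^sub>M P)"
    using finite_I by (intro sets.finite_UN finite_Int) (auto intro!: sets_cyl)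
  finally show ?thesis .
qed

lemma integrable_near:
  assumes f: "f \<in> L2 \<nu>"
  shows "integrable (P \<Otimes>\<^sub>M P) (\<lambda>z. indicator {(x, y). dist (coding F K x) (coding F K y) < r} z *
      (f (coding F K (fst z)) - f (coding F K (snd z)))\<^sup>2)"
  using integrable_mult_indicator[OF near_energy_eq(2)[OF f] pair_L2_integrable[OF L2_coding[OF f]]]
  by (rule Bochner_Integration.integrable_cong[THEN iffD1, rotated 2]) (auto simp: indicator_def case_prod_unfold)

lemma integrable_pair:
  assumes f: "f \<in> L2 \<nu>"
  shows "integrable (P \<Otimes>\<^sub>M P) (\<lambda>z. indicator {(x, y). (map x [0..<n], map y [0..<n]) \<in> R} z *
      (f (coding F K (fst z)) - f (coding F K (snd z)))\<^sup>2)"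
  using integrable_mult_indicator[OF pair_prefix_sets pair_L2_integrable[OF L2_coding[OF f]]]
  by (rule Bochner_Integration.integrable_cong[THEN iffD1, rotated 2]) (auto simp: indicator_def case_prod_unfold)

lemma near_energy_le_pair_energy:
  assumes f: "f \<in> L2 \<nu>"
    and sub: "\<And>x y. range x \<subseteq> I \<Longrightarrow> range y \<subseteq> I \<Longrightarrow> dist (coding F K x) (coding F K y) < r \<Longrightarrow>
      (map x [0..<n], map y [0..<n]) \<in> R"
  shows "near_energy L \<nu> r f \<le> pair_energy R n (\<lambda>\<omega>. f (coding F K \<omega>))"
  unfolding near_energy_eq(1)[OF f] pair_energy_def
  by (intro integral_mono integrable_near integrable_pair f)
     (auto simp: space_pair_measure space_P indicator_def sub)

lemma pair_energy_le_near_energy: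
  assumes f: "f \<in> L2 \<nu>"
    and sub: "\<And>x y. range x \<subseteq> I \<Longrightarrow> range y \<subseteq> I \<Longrightarrow> (map x [0..<n], map y [0..<n]) \<in> R \<Longrightarrow>
      dist (coding F K x) (coding F K y) < r"
  shows "pair_energy R n (\<lambda>\<omega>. f (coding F K \<omega>)) \<le> near_energy L \<nu> r f"
  unfolding near_energy_eq(1)[OF f] pair_energy_def
  by (intro integral_mono integrable_near integrable_pair f)
     (auto simp: space_pair_measure space_P indicator_def sub)

end

section \<open>Transfer of the sequence space estimates to the energies on \<open>L\<close>\<close>

theorem lemma3p1:
  fixes F :: "'i \<Rightarrow> 'a::polish_space \<Rightarrow> 'a"
    and W S I :: "'i set"
    and K L :: "'a set"
    and \<GG> :: "('a \<Rightarrow> 'a) set"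
    and M :: nat
    and \<mu> \<nu> :: "'a measure"
    and \<E> :: "('a \<Rightarrow> real) \<Rightarrow> ('a \<Rightarrow> real) \<Rightarrow> real"
    and \<F> :: "('a \<Rightarrow> real) set"
    and \<alpha> d\<^sub>f d d\<^sub>w \<rho> k\<^sub>1 k\<^sub>2 \<beta> :: real
    and q :: ennreal
  assumes alpha: "\<alpha> > 1"
    and finite_W: "finite W"
    and similitude: "\<And>i x y. i \<in> W \<Longrightarrow> dist (F i x) (F i y) = dist x y / \<alpha>"
    and S_subset: "S \<subseteq> W"
    and K: "compact K" "K \<noteq> {}" "K = (\<Union>i\<in>S. F i ` K)" "connected K"
    and G_group: "subgroup \<GG> (BijGroup K)"
    and G_isometry: "\<And>\<Psi> x y. \<lbrakk>\<Psi> \<in> \<GG>; x \<in> K; y \<in> K\<rbrakk> \<Longrightarrow> dist (\<Psi> x) (\<Psi> y) = dist x y"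
    and G1: "\<And>i. i \<in> W \<Longrightarrow> \<exists>j\<in>S. \<exists>\<Psi>\<in>\<GG>. \<forall>x\<in>K. F i x = F j (\<Psi> x)"
    and G2: "\<And>\<Psi> i. \<lbrakk>\<Psi> \<in> \<GG>; i \<in> S\<rbrakk> \<Longrightarrow>
        \<exists>\<Psi>'\<in>\<GG>. \<exists>i'\<in>S. \<forall>x\<in>K. \<Psi> (F i x) = F i' (\<Psi>' x)"
    and I: "I \<subseteq> W" "card I < card S"
    and L: "compact L" "L \<noteq> {}" "L = (\<Union>i\<in>I. F i ` L)"
    and M_chain: "\<And>i j. \<lbrakk>i \<in> I; j \<in> I\<rbrakk> \<Longrightarrow>
        (i, j) \<in> {(i, j). i \<in> I \<and> j \<in> I \<and> linked F K W I M 1 [i] [j]}\<^sup>*"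
    and mu: "\<mu> = bernoulli_image F K S K"
    and nu: "\<nu> = bernoulli_image F K I L"
    and d\<^sub>f: "d\<^sub>f = ln (card S) / ln \<alpha>"
    and d: "d = ln (card I) / ln \<alpha>"
    and form: "strong_local_regular_dirichlet_form \<mu> \<E> \<F>"
    and A1: "\<exists>C::nat. \<forall>n. \<forall>w\<in>words S n. card (nbhd F K W n 1 {w} \<inter> words S n) \<le> C"
      "\<exists>C::nat. \<forall>n. \<forall>w\<in>words I n. card (nbhd F K W n M {w} \<inter> words I n) \<le> C"
    and k_pos: "k\<^sub>1 > 0" "k\<^sub>2 > 0"
    and A2: "\<And>x y n v w. \<lbrakk>x \<in> L; y \<in> L; v \<in> words I n; w \<in> words I n; x \<in> cell F K v; y \<in> cell F K w\<rbrakk>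
        \<Longrightarrow> (dist x y < k\<^sub>1 / \<alpha> ^ n \<longrightarrow> linked F K W I M n v w) \<and>
            (linked F K W I M n v w \<longrightarrow> dist x y < k\<^sub>2 / \<alpha> ^ n)"
    and A3: "\<exists>k\<^sub>1'>0. \<exists>k\<^sub>2'>0. \<forall>x\<in>K. \<forall>y\<in>K. \<forall>n. \<forall>v\<in>words S n. \<forall>w\<in>words S n.
        x \<in> cell F K v \<longrightarrow> y \<in> cell F K w \<longrightarrow>
            (dist x y < k\<^sub>1' / \<alpha> ^ n \<longrightarrow> cell F K v \<inter> cell F K w \<noteq> {}) \<and>
            (cell F K v \<inter> cell F K w \<noteq> {} \<longrightarrow> dist x y < k\<^sub>2' / \<alpha> ^ n)"
    and A4: "{x \<in> K. infinite {\<omega>. range \<omega> \<subseteq> S \<and> coding F K \<omega> = x}} \<in> null_sets \<mu>"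
      "{x \<in> L. infinite {\<omega>. range \<omega> \<subseteq> I \<and> coding F K \<omega> = x}} \<in> null_sets \<nu>"
    and A5: "\<And>f i. \<lbrakk>f \<in> \<F>; i \<in> S\<rbrakk> \<Longrightarrow> f \<circ> F i \<in> \<F>" "\<rho> > 0"
      "\<And>f. f \<in> \<F> \<Longrightarrow> \<E> f f = \<rho> * (\<Sum>i\<in>S. \<E> (f \<circ> F i) (f \<circ> F i))"
    and A6: "\<And>\<Psi> f. \<lbrakk>\<Psi> \<in> \<GG>; f \<in> \<F>\<rbrakk> \<Longrightarrow> f \<circ> \<Psi> \<in> \<F>"
      "\<And>\<Psi> g. \<lbrakk>\<Psi> \<in> \<GG>; g \<in> \<F>\<rbrakk> \<Longrightarrow> \<exists>f\<in>\<F>. AE x in \<mu>. g x = f (\<Psi> x)"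
      "\<And>\<Psi> f. \<lbrakk>\<Psi> \<in> \<GG>; f \<in> \<F>\<rbrakk> \<Longrightarrow> \<E> (f \<circ> \<Psi>) (f \<circ> \<Psi>) = \<E> f f"
    and A7: "d\<^sub>w = ln (\<rho> * card S) / ln \<alpha>" "d\<^sub>w > d\<^sub>f - d"
    and A8: "\<exists>c>0. \<forall>D. compact D \<and> D \<subseteq> K \<longrightarrow> emeasure \<nu> (D \<inter> L) \<le> ennreal c * cap \<mu> \<E> \<F> D"
    and beta: "\<beta> > 0"
    and q: "1 \<le> q"
  shows "\<exists>c\<^sub>1>0. \<forall>f\<in>L2 \<nu>.
      ennreal c\<^sub>1 *
        lq_norm q (\<lambda>n. \<alpha> powr (n * \<beta>) * sqrt (\<alpha> powr (n * d) * near_energy L \<nu> (k\<^sub>1 / \<alpha> ^ n) f))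
      \<le> lq_norm q (\<lambda>n. \<alpha> powr (n * \<beta>) *
          sqrt (\<alpha> powr (- (n * d)) * disc_energy F K W I M n (cell_avg F L \<nu> f)))
    \<and> lq_norm q (\<lambda>n. \<alpha> powr (n * \<beta>) *
          sqrt (\<alpha> powr (- (n * d)) * disc_energy F K W I M n (cell_avg F L \<nu> f)))
      \<le> lq_norm q (\<lambda>n. \<alpha> powr (n * \<beta>) * sqrt (\<alpha> powr (n * d) * near_energy L \<nu> (k\<^sub>2 / \<alpha> ^ n) f))"
proof -
  have finite_I: "finite I"
    using I(1) finite_W by (rule finite_subset)
  \<comment> \<open>By condition (i), \<open>F i\<close> agrees on \<open>K\<close> with some
    \<open>F j\<close> for \<open>j\<close> in \<open>S\<close> preceded by a bijection of
    \<open>K\<close>; so both have the same image of \<open>K\<close>, which lies in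
    \<open>K\<close>.\<close>
  have F_K: "F i ` K \<subseteq> K" if "i \<in> I" for i
  proof -
    have "i \<in> W" using that I(1) by blast
    then obtain j \<Psi> where j: "j \<in> S" "\<Psi> \<in> \<GG>" "\<forall>x\<in>K. F i x = F j (\<Psi> x)"
      using G1 by blast
    have "\<Psi> \<in> Bij K"
      using subgroup.subset[OF G_group] j(2) by (auto simp: BijGroup_def)
    then have \<Psi>: "\<Psi> ` K = K"
      by (auto simp: Bij_def bij_betw_def)
    have "F i ` K = (\<lambda>x. F j (\<Psi> x)) ` K"
      using j(3) by (intro image_cong) auto
    also have "\<dots> = F j ` K"
      unfolding image_image[symmetric] \<Psi> ..
    also have "\<dots> \<subseteq> K"
      using K(3) j(1) by blast
    finally show ?thesis .
  qed
  interpret self_similar F K L I \<alpha>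
  proof unfold_locales
    show "dist (F i x) (F i y) = dist x y / \<alpha>" if "i \<in> I" for i x y
      using similitude I(1) that by blast
  qed (fact alpha finite_I K(1,2) F_K L)+
  define R where "R n = {(v, w). linked F K W I M n v w}" for n
  define E where "E = {(i, j). i \<in> I \<and> j \<in> I \<and> linked F K W I M 1 [i] [j]}"
  obtain C where C: "\<And>n w. w \<in> words I n \<Longrightarrow> card (nbhd F K W n M {w} \<inter> words I n) \<le> C"
    using A1(2) by blast
  have null: "{x \<in> L. infinite {\<omega>. range \<omega> \<subseteq> I \<and> coding F K \<omega> = x}} \<in> null_sets (bernoulli_image F K I L)"
    using A4(2) by (simp add: nu)
  \<comment> \<open>The exponent \<open>d\<close> is chosen so that \<open>\<alpha> powr d\<close>
    is the number of letters; thus \<open>\<alpha> powr (real n * d)\<close> is the reciprocal of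
    the measure of a cell of level \<open>n\<close>.\<close>
  have N: "\<alpha> powr (real n * d) = N ^ n" for n
  proof -
    have "\<alpha> powr d = N"
      using alpha N_pos by (simp add: d powr_def)
    then have "\<alpha> powr (real n * d) = N powr real n"
      unfolding powr_powr[symmetric] mult.commute[of "real n"] by simp
    then show ?thesis using N_pos by (simp add: powr_realpow)
  qed
  \<comment> \<open>Positivity of \<open>\<beta>\<close> enters as \<open>s > 1\<close>, which makes
    the ratio \<open>1 / s\<close> of the recursion a contraction.\<close>
  define s where "s = \<alpha> powr \<beta>"
  have s: "s > 1"
    using alpha beta by (simp add: s_def)
  have s_pow: "\<alpha> powr (real n * \<beta>) = s ^ n" for n
    unfolding s_def using alpha by (simp add: powr_realpow[symmetric] powr_powr mult.commute)
  have R_words: "R n \<subseteq> words I n \<times> words I n" for n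
    by (auto simp: R_def linked_def)
  have "\<exists>c>0. \<forall>h\<in>L2 P. ennreal c * lq_norm q (\<lambda>n. s ^ n * sqrt (N ^ n * pair_energy (R n) n h))
     \<le> lq_norm q (\<lambda>n. s ^ n * sqrt (avg_energy (R n) n h / N ^ n))"
  proof (rule lq_norm_pair_energy_le[OF q s R_words])
    show "sym (R n)" for n
      using linked_sym[OF I(1)] by (auto simp: sym_def R_def)
    show "card {v. (v, w) \<in> R n} \<le> C" if "w \<in> words I n" for n w
    proof -
      have "{v. (v, w) \<in> R n} = nbhd F K W n M {w} \<inter> words I n"
        using that by (auto simp: R_def linked_def)
      then show ?thesis using C[OF that] by simp
    qed
    show "E \<subseteq> I \<times> I"
      by (auto simp: E_def)
    show "(i, j) \<in> E\<^sup>*" if "i \<in> I" "j \<in> I" for i j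
      using M_chain[OF that] by (simp add: E_def)
    show "(u @ [i], u @ [j]) \<in> R (Suc n)" if "u \<in> words I n" "(i, j) \<in> E" for n u i j
      using linked_append[OF I(1) that(1), of F K M 1 "[i]" "[j]"] that(2) by (simp add: E_def R_def)
  qed
  then obtain c where c: "c > 0" "\<And>h. h \<in> L2 P \<Longrightarrow>
      ennreal c * lq_norm q (\<lambda>n. s ^ n * sqrt (N ^ n * pair_energy (R n) n h))
      \<le> lq_norm q (\<lambda>n. s ^ n * sqrt (avg_energy (R n) n h / N ^ n))"
    by blast
  have lq_sqrt_mono: "lq_norm q (\<lambda>n. s ^ n * sqrt (X n)) \<le> lq_norm q (\<lambda>n. s ^ n * sqrt (Y n))"
    if XY: "\<And>n. 0 \<le> X n" "\<And>n. X n \<le> Y n" for X Y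
  proof (intro lq_norm_mono q)
    fix n
    have "s ^ n * sqrt (X n) \<le> s ^ n * sqrt (Y n)"
      using s XY(2) by (intro mult_left_mono real_sqrt_le_mono) auto
    moreover have "0 \<le> s ^ n * sqrt (X n)"
      using s XY(1) by simp
    ultimately show "\<bar>s ^ n * sqrt (X n)\<bar> \<le> \<bar>s ^ n * sqrt (Y n)\<bar>"
      by linarith
  qed
  show ?thesis
  proof (intro exI[of _ c] conjI ballI c(1))
    fix f assume "f \<in> L2 \<nu>"
    then have f: "f \<in> L2 (bernoulli_image F K I L)" by (simp add: nu)
    define h where "h \<omega> = f (coding F K \<omega>)" for \<omega>
    have h: "h \<in> L2 P"
      using L2_coding[OF f] by (simp add: h_def[abs_def])
    have disc: "disc_energy F K W I M n (cell_avg F L \<nu> f) = avg_energy (R n) n h" for n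
    proof -
      have "cell_avg F L \<nu> f w = N ^ n * mass h w" if "w \<in> words I n" for w
        using cell_avg_eq[OF null f that] by (simp add: nu h_def[abs_def])
      then show ?thesis
        unfolding disc_energy_def avg_energy_def R_def[symmetric] using R_words[of n]
        by (intro sum.cong refl) auto
    qed
    have avg: "s ^ n * sqrt (\<alpha> powr (- (real n * d)) * disc_energy F K W I M n (cell_avg F L \<nu> f))
        = s ^ n * sqrt (avg_energy (R n) n h / N ^ n)" for n
      by (simp add: disc powr_minus N divide_inverse mult.commute[of "inverse (N ^ n)"])
    have near_nonneg: "0 \<le> near_energy L \<nu> r f" for r
      unfolding near_energy_def set_lebesgue_integral_def by (intro integral_nonneg_AE AE_I2) auto
    \<comment> \<open>(A2) is used at coded points: they lie in \<open>L\<close> and in the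
      \<open>K\<close>-cells of their prefixes, so closeness forces linked prefixes, and for
      \<open>near2\<close> conversely.\<close>
    have near1: "near_energy L \<nu> (k\<^sub>1 / \<alpha> ^ n) f \<le> pair_energy (R n) n h" for n
      unfolding nu h_def
    proof (rule near_energy_le_pair_energy[OF f])
      fix x y :: "nat \<Rightarrow> 'i"
      assume "range x \<subseteq> I" "range y \<subseteq> I" "dist (coding F K x) (coding F K y) < k\<^sub>1 / \<alpha> ^ n"
      then show "(map x [0..<n], map y [0..<n]) \<in> R n"
        using A2[OF coding_mem_L coding_mem_L prefix_mem_words prefix_mem_words coding_mem_cell_K coding_mem_cell_K]
        by (simp add: R_def)
    qed
    have near2: "pair_energy (R n) n h \<le> near_energy L \<nu> (k\<^sub>2 / \<alpha> ^ n) f" for n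
      unfolding nu h_def
    proof (rule pair_energy_le_near_energy[OF f])
      fix x y :: "nat \<Rightarrow> 'i"
      assume "range x \<subseteq> I" "range y \<subseteq> I" "(map x [0..<n], map y [0..<n]) \<in> R n"
      then show "dist (coding F K x) (coding F K y) < k\<^sub>2 / \<alpha> ^ n"
        using A2[OF coding_mem_L coding_mem_L prefix_mem_words prefix_mem_words coding_mem_cell_K coding_mem_cell_K]
        by (simp add: R_def)
    qed
    have "lq_norm q (\<lambda>n. s ^ n * sqrt (N ^ n * near_energy L \<nu> (k\<^sub>1 / \<alpha> ^ n) f))
        \<le> lq_norm q (\<lambda>n. s ^ n * sqrt (N ^ n * pair_energy (R n) n h))"
      using N_pos near1 near_nonneg by (intro lq_sqrt_mono mult_left_mono) auto
    then show "ennreal c * lq_norm q (\<lambda>n. \<alpha> powr (n * \<beta>) * sqrt (\<alpha> powr (n * d) * near_energy L \<nu> (k\<^sub>1 / \<alpha> ^ n) f))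
      \<le> lq_norm q (\<lambda>n. \<alpha> powr (n * \<beta>) *
          sqrt (\<alpha> powr (- (n * d)) * disc_energy F K W I M n (cell_avg F L \<nu> f)))"
      unfolding s_pow avg unfolding N by (intro order_trans[OF mult_left_mono c(2)[OF h]]) auto
    \<comment> \<open>For the upper bound the variances are simply discarded, so no constant
      appears.\<close>
    have "avg_energy (R n) n h / N ^ n \<le> N ^ n * near_energy L \<nu> (k\<^sub>2 / \<alpha> ^ n) f" for n
    proof -
      have "N ^ n * pair_energy (R n) n h \<le> N ^ n * near_energy L \<nu> (k\<^sub>2 / \<alpha> ^ n) f"
        using near2 N_pos by (intro mult_left_mono) auto
      with avg_energy_le_pair_energy[OF h R_words] show ?thesis
        by (rule order_trans)
    qed
    then show "lq_norm q (\<lambda>n. \<alpha> powr (n * \<beta>) *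
          sqrt (\<alpha> powr (- (n * d)) * disc_energy F K W I M n (cell_avg F L \<nu> f)))
      \<le> lq_norm q (\<lambda>n. \<alpha> powr (n * \<beta>) * sqrt (\<alpha> powr (n * d) * near_energy L \<nu> (k\<^sub>2 / \<alpha> ^ n) f))"
      unfolding s_pow avg unfolding N using N_pos avg_energy_nonneg
      by (intro lq_sqrt_mono) auto
  qed
qed

end
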